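(* Let $q$ be a non-zero complex number with $|q|\neq 1$ such that $\theta=\frac{1}{\pi}\arg(q)$ is irrational. Then the conditional expectation $E_\phi:C(U_q(2))\to C(U_q(2)/_\phi\mathbb{T})$ has infinite Watatani index, i.e. $E_\phi$ is not of index-finite type.
   Context: For a non-zero complex number $q$, $C(U_q(2))$ denotes the universal unital $C^*$-algebra generated by elements $a,b,D$ satisfying $$ba=q\,ab,\quad a^*b=q\,ba^*,\quad bb^*=b^*b,\quad aa^*+bb^*=1,$$ $$aD=Da,\quad bD=q^2|q|^{-2}Db,\quad DD^*=D^*D=1,\quad a^*a+|q|^2b^*b=1,$$ with comultiplication the unital $*$-homomorphism $\Delta:C(U_q(2))\to C(U_q(2))\otimes C(U_q(2))$ given by $$\Delta(a)=a\otimes a-\bar q\,b\otimes Db^*,\quad \Delta(b)=a\otimes b+b\otimes Da^*,\quad \Delta(D)=D\otimes D.$$ Let $\mathbf{t}:z\mapsto z$ be the standard unitary generator of $C(\mathbb{T})$ and let $h_{\mathbb{T}}$ be the Haar state on $C(\mathbb{T})$ (integration against normalized Lebesgue measure on the circle). Let $\phi:C(U_q(2))\to C(\mathbb{T})$ be the unital $*$-homomorphism with $\phi(a)=1$, $\phi(b)=0$, $\phi(D)=\mathbf{t}$. Define $$C(U_q(2)/_\phi\mathbb{T})=\{x\in C(U_q(2)):(\phi\otimes\mathrm{id})\Delta(x)=1\otimes x\},\qquad E_\phi=((h_{\mathbb{T}}\circ\phi)\otimes\mathrm{id})\circ\Delta,$$ which is a conditional expectation from $C(U_q(2))$ onto $C(U_q(2)/_\phi\mathbb{T})$.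 For a unital inclusion of $C^*$-algebras $\mathcal{B}\subset\mathcal{A}$, a conditional expectation $E:\mathcal{A}\to\mathcal{B}$ is of index-finite type if there is a finite set $\{(u_j,v_j):1\le j\le n\}\subseteq\mathcal{A}\times\mathcal{A}$ (a quasi-basis) such that $x=\sum_j u_jE(v_jx)=\sum_j E(xu_j)v_j$ for all $x\in\mathcal{A}$; in that case its Watatani index is $\sum_j u_jv_j$. $E$ has infinite Watatani index if it is not of index-finite type. *)

theory Defs
  imports "HOL-Analysis.Analysis"
begin

section \<open>Unital C*-algebras\<close>

class scaleC =
  fixes scaleC :: "complex \<Rightarrow> 'a \<Rightarrow> 'a"  (infixr \<open>*\<^sub>C\<close> 75)

class star =
  fixes star :: "'a \<Rightarrow> 'a"

text \<open>The superclass \<^class>\<open>real_normed_algebra_1\<close> contains \<open>norm 1 = 1\<close>, so these are the non-zero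
  unital C*-algebras.\<close>

class cstar_algebra = real_normed_algebra_1 + complete_space + scaleC + star +
  assumes scaleC_add_right: "c *\<^sub>C (x + y) = c *\<^sub>C x + c *\<^sub>C y"
    and scaleC_add_left: "(c + d) *\<^sub>C x = c *\<^sub>C x + d *\<^sub>C x"
    and scaleC_scaleC: "c *\<^sub>C d *\<^sub>C x = (c * d) *\<^sub>C x"
    and scaleR_scaleC: "r *\<^sub>R x = complex_of_real r *\<^sub>C x"
    and scaleC_mult_left: "(c *\<^sub>C x) * y = c *\<^sub>C (x * y)"
    and scaleC_mult_right: "x * (c *\<^sub>C y) = c *\<^sub>C (x * y)"
    and norm_scaleC: "norm (c *\<^sub>C x) = cmod c * norm x"
    and star_star: "star (star x) = x"
    and star_add: "star (x + y) = star x + star y"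
    and star_scaleC: "star (c *\<^sub>C x) = cnj c *\<^sub>C star x"
    and star_mult: "star (x * y) = star y * star x"
    and norm_star_mult_self: "norm (star x * x) = (norm x)\<^sup>2"

definition star_hom :: "('a::cstar_algebra \<Rightarrow> 'b::cstar_algebra) \<Rightarrow> bool" where
  "star_hom f \<longleftrightarrow>
     (\<forall>x y. f (x + y) = f x + f y) \<and> (\<forall>c x. f (c *\<^sub>C x) = c *\<^sub>C f x) \<and>
     (\<forall>x y. f (x * y) = f x * f y) \<and> f 1 = 1 \<and> (\<forall>x. f (star x) = star (f x))"

definition cstar_subalgebra :: "'a::cstar_algebra set \<Rightarrow> bool" where
  "cstar_subalgebra B \<longleftrightarrow>
     1 \<in> B \<and> (\<forall>x\<in>B. \<forall>y\<in>B. x + y \<in> B) \<and> (\<forall>c. \<forall>x\<in>B. c *\<^sub>C x \<in> B) \<and>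
     (\<forall>x\<in>B. \<forall>y\<in>B. x * y \<in> B) \<and> (\<forall>x\<in>B. star x \<in> B) \<and> closed B"

definition cstar_generates :: "'a::cstar_algebra set \<Rightarrow> bool" where
  "cstar_generates S \<longleftrightarrow> (\<forall>B. cstar_subalgebra B \<longrightarrow> S \<subseteq> B \<longrightarrow> B = UNIV)"

instantiation complex :: cstar_algebra
begin

definition scaleC_complex :: "complex \<Rightarrow> complex \<Rightarrow> complex" where "scaleC_complex c x = c * x"
definition star_complex :: "complex \<Rightarrow> complex" where "star_complex x = cnj x"

instance
  by standard (auto simp: scaleC_complex_def star_complex_def algebra_simps scaleR_conv_of_real
      norm_mult power2_eq_square)

end

lemma norm_star_eq: "norm (star x) = norm (x::'a::cstar_algebra)"
proof -
  have le: "norm y \<le> norm (star y)" for y :: 'a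
  proof (cases "norm y = 0")
    case False
    have "norm y * norm y \<le> norm (star y) * norm y"
      using norm_mult_ineq[of "star y" y] by (simp add: norm_star_mult_self power2_eq_square)
    then show ?thesis using False by simp
  qed simp
  from le[of x] le[of "star x"] show ?thesis by (simp add: star_star)
qed

lemma star_diff_aux: "star (x - y) = star x - star (y::'a::cstar_algebra)"
  by (metis add_diff_cancel_right' diff_add_cancel star_add)

lemma continuous_on_star_aux: "continuous_on S (star :: 'a::cstar_algebra \<Rightarrow> 'a)"
  by (rule continuous_onI) (auto simp: dist_norm norm_star_eq simp flip: star_diff_aux)

lemma continuous_on_scaleC_aux: "continuous_on S (scaleC c :: 'a::cstar_algebra \<Rightarrow> 'a)"
proof -
  have "bounded_linear (scaleC c :: 'a \<Rightarrow> 'a)"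
    by (rule bounded_linear_intro[where K = "cmod c"])
       (auto simp: scaleC_add_right norm_scaleC scaleR_scaleC scaleC_scaleC mult.commute)
  then show ?thesis by (rule linear_continuous_on)
qed


section \<open>Continuous functions on the circle\<close>

setup_lifting type_definition_bcontfun

instantiation bcontfun :: (metric_space, cstar_algebra) cstar_algebra
begin

lift_definition one_bcontfun :: "'a \<Rightarrow>\<^sub>C 'b" is "\<lambda>_. 1"
  by (rule const_bcontfun)

lift_definition times_bcontfun :: "('a \<Rightarrow>\<^sub>C 'b) \<Rightarrow> ('a \<Rightarrow>\<^sub>C 'b) \<Rightarrow> 'a \<Rightarrow>\<^sub>C 'b" is "\<lambda>f g x. f x * g x"
proof -
  fix f g :: "'a \<Rightarrow> 'b" assume f: "f \<in> bcontfun" and g: "g \<in> bcontfun"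
  from f g obtain b c where b: "\<And>x. norm (f x) \<le> b" and c: "\<And>x. norm (g x) \<le> c"
    by (auto simp: bcontfun_def bounded_iff)
  have "norm (f x * g x) \<le> b * c" for x
    by (rule order_trans[OF norm_mult_ineq])
       (use b c in \<open>auto intro!: mult_mono order_trans[OF norm_ge_zero b]\<close>)
  then have "bounded (range (\<lambda>x. f x * g x))" by (auto simp: bounded_iff)
  with f g show "(\<lambda>x. f x * g x) \<in> bcontfun"
    by (auto simp: bcontfun_def intro!: continuous_intros)
qed

lift_definition star_bcontfun :: "('a \<Rightarrow>\<^sub>C 'b) \<Rightarrow> 'a \<Rightarrow>\<^sub>C 'b" is "\<lambda>f x. star (f x)"
  by (auto simp: bcontfun_def bounded_iff norm_star_eq
      intro: continuous_on_compose2[OF continuous_on_star_aux[of UNIV]])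

lift_definition scaleC_bcontfun :: "complex \<Rightarrow> ('a \<Rightarrow>\<^sub>C 'b) \<Rightarrow> 'a \<Rightarrow>\<^sub>C 'b" is "\<lambda>c f x. c *\<^sub>C f x"
proof -
  fix c and f :: "'a \<Rightarrow> 'b" assume f: "f \<in> bcontfun"
  from f obtain b where b: "\<And>x. norm (f x) \<le> b"
    by (auto simp: bcontfun_def bounded_iff)
  have "norm (c *\<^sub>C f x) \<le> cmod c * b" for x
    using b[of x] by (simp add: norm_scaleC mult_left_mono)
  then have "bounded (range (\<lambda>x. c *\<^sub>C f x))" by (auto simp: bounded_iff)
  moreover have "continuous_on UNIV (\<lambda>x. c *\<^sub>C f x)"
    by (rule continuous_on_compose2[OF continuous_on_scaleC_aux[of UNIV]])
       (use f in \<open>auto simp: bcontfun_def\<close>)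
  ultimately show "(\<lambda>x. c *\<^sub>C f x) \<in> bcontfun" by (simp add: bcontfun_def)
qed

instance
proof
  fix f g h :: "'a \<Rightarrow>\<^sub>C 'b" and c d :: complex and r :: real
  note rep = one_bcontfun.rep_eq times_bcontfun.rep_eq star_bcontfun.rep_eq scaleC_bcontfun.rep_eq
  show "f * g * h = f * (g * h)" "(f + g) * h = f * h + g * h" "f * (g + h) = f * g + f * h"
    "1 * f = f" "f * 1 = f" "r *\<^sub>R f * g = r *\<^sub>R (f * g)" "f * r *\<^sub>R g = r *\<^sub>R (f * g)"
    by (rule bcontfun_eqI; simp add: rep algebra_simps)+
  show "(0 :: 'a \<Rightarrow>\<^sub>C 'b) \<noteq> 1"
  proof
    assume "(0 :: 'a \<Rightarrow>\<^sub>C 'b) = 1"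
    then have "apply_bcontfun (0 :: 'a \<Rightarrow>\<^sub>C 'b) undefined = apply_bcontfun 1 undefined" by simp
    then show False by (simp add: rep)
  qed
  show "norm (f * g) \<le> norm f * norm g"
  proof (rule norm_bound)
    fix x
    have "norm (apply_bcontfun (f * g) x) \<le> norm (apply_bcontfun f x) * norm (apply_bcontfun g x)"
      by (simp add: times_bcontfun.rep_eq norm_mult_ineq)
    also have "\<dots> \<le> norm f * norm g" by (intro mult_mono norm_bounded) auto
    finally show "norm (apply_bcontfun (f * g) x) \<le> norm f * norm g" .
  qed
  show "norm (1 :: 'a \<Rightarrow>\<^sub>C 'b) = 1"
    using norm_bounded[of "1 :: 'a \<Rightarrow>\<^sub>C 'b" undefined] norm_bound[of "1 :: 'a \<Rightarrow>\<^sub>C 'b" 1]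
    by (simp add: one_bcontfun.rep_eq)
  show "c *\<^sub>C (f + g) = c *\<^sub>C f + c *\<^sub>C g" "(c + d) *\<^sub>C f = c *\<^sub>C f + d *\<^sub>C f"
    "c *\<^sub>C d *\<^sub>C f = (c * d) *\<^sub>C f" "r *\<^sub>R f = complex_of_real r *\<^sub>C f"
    "c *\<^sub>C f * g = c *\<^sub>C (f * g)" "f * c *\<^sub>C g = c *\<^sub>C (f * g)"
    "star (star f) = f" "star (f + g) = star f + star g" "star (c *\<^sub>C f) = cnj c *\<^sub>C star f"
    "star (f * g) = star g * star f"
    by (rule bcontfun_eqI; simp add: rep scaleC_add_right scaleC_add_left scaleC_scaleC scaleR_scaleC
        scaleC_mult_left scaleC_mult_right star_star star_add star_scaleC star_mult)+
  show "norm (c *\<^sub>C f) = cmod c * norm f"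
  proof (cases "c = 0")
    case True
    have "0 *\<^sub>C x = (0::'b)" for x using scaleR_scaleC[of 0 x] by simp
    with True have "c *\<^sub>C f = 0" by (auto intro!: bcontfun_eqI simp: scaleC_bcontfun.rep_eq)
    with True show ?thesis by simp
  next
    case False
    have le: "norm (c *\<^sub>C f) \<le> cmod c * norm f" for c and f :: "'a \<Rightarrow>\<^sub>C 'b"
      by (rule norm_bound)
         (simp add: scaleC_bcontfun.rep_eq norm_scaleC mult_left_mono norm_bounded)
    have "inverse c *\<^sub>C c *\<^sub>C f = f"
    proof (rule bcontfun_eqI)
      fix x
      have "inverse c *\<^sub>C c *\<^sub>C y = y" for y :: 'b
        using False scaleR_scaleC[of 1 y] by (simp add: scaleC_scaleC)
      then show "apply_bcontfun (inverse c *\<^sub>C c *\<^sub>C f) x = apply_bcontfun f x"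
        by (simp add: scaleC_bcontfun.rep_eq)
    qed
    with le[of "inverse c" "c *\<^sub>C f"] False have "cmod c * norm f \<le> norm (c *\<^sub>C f)"
      by (simp add: norm_inverse norm_divide field_simps)
    with le[of c f] show ?thesis by simp
  qed
  show "norm (star f * f) = (norm f)\<^sup>2"
  proof (rule antisym)
    show "norm (star f * f) \<le> (norm f)\<^sup>2"
    proof (rule norm_bound)
      fix x
      show "norm (apply_bcontfun (star f * f) x) \<le> (norm f)\<^sup>2"
        by (simp add: times_bcontfun.rep_eq star_bcontfun.rep_eq norm_star_mult_self
            power_mono norm_bounded)
    qed
    have "norm f \<le> sqrt (norm (star f * f))"
    proof (rule norm_bound)
      fix x
      have "(norm (apply_bcontfun f x))\<^sup>2 \<le> norm (star f * f)"
        using norm_bounded[of "star f * f" x]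
        by (simp add: times_bcontfun.rep_eq star_bcontfun.rep_eq norm_star_mult_self)
      then show "norm (apply_bcontfun f x) \<le> sqrt (norm (star f * f))"
        by (rule real_le_rsqrt)
    qed
    then show "(norm f)\<^sup>2 \<le> norm (star f * f)"
      by (metis norm_ge_zero power_mono real_sqrt_pow2)
  qed
qed

end

typedef circle = "sphere (0::complex) 1"
  morphisms of_circle Circle
  by (rule exI[of _ 1]) simp

instantiation circle :: metric_space
begin

definition dist_circle :: "circle \<Rightarrow> circle \<Rightarrow> real" where
  "dist_circle z w = dist (of_circle z) (of_circle w)"
definition uniformity_circle :: "(circle \<times> circle) filter" where
  "uniformity_circle = (INF e\<in>{0 <..}. principal {(x, y). dist x y < e})"
definition open_circle :: "circle set \<Rightarrow> bool" where
  "open_circle U = (\<forall>x\<in>U. \<forall>\<^sub>F (x', y) in uniformity. x' = x \<longrightarrow> y \<in> U)"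

instance
  by standard (auto simp: dist_circle_def of_circle_inject uniformity_circle_def open_circle_def
      intro: dist_triangle2)

end

type_synonym C_circle = "circle \<Rightarrow>\<^sub>C complex"

lift_definition circle_t :: C_circle is of_circle
proof -
  have "continuous_on UNIV of_circle"
    by (rule continuous_onI) (auto simp: dist_circle_def)
  moreover have "bounded (range of_circle)"
    using of_circle by (auto simp: bounded_iff intro!: exI[of _ 1])
  ultimately show "of_circle \<in> bcontfun" by (simp add: bcontfun_def)
qed

text \<open>Arc length is normalized by the parametrization over the unit interval.\<close>

definition haar_circle :: "C_circle \<Rightarrow> complex" where
  "haar_circle f = integral {0..1} (\<lambda>s. apply_bcontfun f (Circle (cis (2 * pi * s))))"


section \<open>Bounded operators on \<open>\<ell>\<^sup>2\<close>\<close>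

typedef 'i ell2 = "{f :: 'i \<Rightarrow> complex. (\<lambda>i. (cmod (f i))\<^sup>2) summable_on UNIV}"
  morphisms ell2_apply Abs_ell2
  by (rule exI[of _ "\<lambda>_. 0"]) simp

setup_lifting type_definition_ell2

lemma ell2_eqI: "(\<And>i. ell2_apply x i = ell2_apply y i) \<Longrightarrow> x = y"
  by transfer auto

lemma ell2_sq_summable: "(\<lambda>i. (cmod (ell2_apply x i))\<^sup>2) summable_on UNIV"
  using ell2_apply[of x] by simp

lemma sq_summable_add:
  assumes "(\<lambda>i. (cmod (f i))\<^sup>2) summable_on UNIV" "(\<lambda>i. (cmod (g i))\<^sup>2) summable_on UNIV"
  shows "(\<lambda>i. (cmod (f i + g i))\<^sup>2) summable_on UNIV"
proof (rule summable_on_comparison_test)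
  show "(\<lambda>i. 2 * (cmod (f i))\<^sup>2 + 2 * (cmod (g i))\<^sup>2) summable_on UNIV"
    using assms by (intro summable_on_add summable_on_cmult_right)
  fix i
  have "(cmod (f i + g i))\<^sup>2 \<le> (cmod (f i) + cmod (g i))\<^sup>2"
    by (intro power_mono norm_triangle_ineq) auto
  also have "\<dots> \<le> 2 * (cmod (f i))\<^sup>2 + 2 * (cmod (g i))\<^sup>2"
    using sum_squares_bound[of "cmod (f i)" "cmod (g i)"] by (simp add: power2_sum)
  finally show "(cmod (f i + g i))\<^sup>2 \<le> 2 * (cmod (f i))\<^sup>2 + 2 * (cmod (g i))\<^sup>2" .
qed auto

lemma sq_summable_scale:
  assumes "(\<lambda>i. (cmod (f i))\<^sup>2) summable_on UNIV"
  shows "(\<lambda>i. (cmod (c * f i))\<^sup>2) summable_on UNIV"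
  using summable_on_cmult_right[OF assms, of "(cmod c)\<^sup>2"]
  by (simp add: norm_mult power_mult_distrib)

instantiation ell2 :: (type) "{real_vector, scaleC}"
begin

lift_definition zero_ell2 :: "'a ell2" is "\<lambda>_. 0" by simp
lift_definition plus_ell2 :: "'a ell2 \<Rightarrow> 'a ell2 \<Rightarrow> 'a ell2" is "\<lambda>f g i. f i + g i"
  by (rule sq_summable_add)
lift_definition uminus_ell2 :: "'a ell2 \<Rightarrow> 'a ell2" is "\<lambda>f i. - f i" by simp
definition minus_ell2 :: "'a ell2 \<Rightarrow> 'a ell2 \<Rightarrow> 'a ell2" where "minus_ell2 f g = f + - g"
lift_definition scaleC_ell2 :: "complex \<Rightarrow> 'a ell2 \<Rightarrow> 'a ell2" is "\<lambda>c f i. c * f i"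
  by (rule sq_summable_scale)
definition scaleR_ell2 :: "real \<Rightarrow> 'a ell2 \<Rightarrow> 'a ell2" where
  "scaleR_ell2 r f = complex_of_real r *\<^sub>C f"

instance
proof
  fix x y z :: "'a ell2" and r s :: real
  show "x + y + z = x + (y + z)" "x + y = y + x" "0 + x = x" "- x + x = 0" "x - y = x + - y"
    "r *\<^sub>R (x + y) = r *\<^sub>R x + r *\<^sub>R y" "(r + s) *\<^sub>R x = r *\<^sub>R x + s *\<^sub>R x"
    "r *\<^sub>R s *\<^sub>R x = (r * s) *\<^sub>R x" "1 *\<^sub>R x = x"
    by (rule ell2_eqI; simp add: minus_ell2_def scaleR_ell2_def zero_ell2.rep_eq plus_ell2.rep_eq
        uminus_ell2.rep_eq scaleC_ell2.rep_eq algebra_simps)+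
qed

end

definition cinner :: "'i ell2 \<Rightarrow> 'i ell2 \<Rightarrow> complex" where
  "cinner x y = (\<Sum>\<^sub>\<infinity>i. cnj (ell2_apply x i) * ell2_apply y i)"

lemma cinner_abs_summable:
  "(\<lambda>i. norm (cnj (ell2_apply x i) * ell2_apply y i)) summable_on UNIV"
proof (rule summable_on_comparison_test)
  show "(\<lambda>i. (cmod (ell2_apply x i))\<^sup>2 + (cmod (ell2_apply y i))\<^sup>2) summable_on UNIV"
    by (intro summable_on_add ell2_sq_summable)
  fix i
  have "2 * (cmod (ell2_apply x i) * cmod (ell2_apply y i)) \<le>
        (cmod (ell2_apply x i))\<^sup>2 + (cmod (ell2_apply y i))\<^sup>2"
    using sum_squares_bound[of "cmod (ell2_apply x i)" "cmod (ell2_apply y i)"] by simp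
  moreover have "0 \<le> cmod (ell2_apply x i) * cmod (ell2_apply y i)" by simp
  ultimately have "cmod (ell2_apply x i) * cmod (ell2_apply y i) \<le>
        (cmod (ell2_apply x i))\<^sup>2 + (cmod (ell2_apply y i))\<^sup>2" by linarith
  then show "norm (cnj (ell2_apply x i) * ell2_apply y i) \<le>
        (cmod (ell2_apply x i))\<^sup>2 + (cmod (ell2_apply y i))\<^sup>2"
    by (simp add: norm_mult)
qed auto

lemma cinner_summable: "(\<lambda>i. cnj (ell2_apply x i) * ell2_apply y i) summable_on UNIV"
  by (rule abs_summable_summable[OF cinner_abs_summable])

lemma cinner_add_left: "cinner (x + y) z = cinner x z + cinner y z"
  unfolding cinner_def plus_ell2.rep_eq complex_cnj_add distrib_right
  by (rule infsum_add[OF cinner_summable cinner_summable])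

lemma cinner_add_right: "cinner x (y + z) = cinner x y + cinner x z"
  unfolding cinner_def plus_ell2.rep_eq distrib_left
  by (rule infsum_add[OF cinner_summable cinner_summable])

lemma cinner_scaleC_left: "cinner (c *\<^sub>C x) y = cnj c * cinner x y"
  unfolding cinner_def
  by (simp add: scaleC_ell2.rep_eq mult.assoc flip: infsum_cmult_right')

lemma cinner_scaleC_right: "cinner x (c *\<^sub>C y) = c * cinner x y"
  unfolding cinner_def
  by (simp add: scaleC_ell2.rep_eq mult.left_commute flip: infsum_cmult_right')

lemma cinner_commute: "cinner x y = cnj (cinner y x)"
  unfolding cinner_def by (simp add: mult.commute flip: infsum_cnj)

lemma cinner_self: "cinner x x = complex_of_real (\<Sum>\<^sub>\<infinity>i. (cmod (ell2_apply x i))\<^sup>2)"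
proof -
  have "((\<lambda>i. complex_of_real ((cmod (ell2_apply x i))\<^sup>2)) has_sum
      complex_of_real (\<Sum>\<^sub>\<infinity>i. (cmod (ell2_apply x i))\<^sup>2)) UNIV"
    by (rule has_sum_of_real[OF has_sum_infsum[OF ell2_sq_summable]])
  moreover have "complex_of_real ((cmod (ell2_apply x i))\<^sup>2) = cnj (ell2_apply x i) * ell2_apply x i"
    for i by (simp only: complex_norm_square mult.commute)
  ultimately show ?thesis unfolding cinner_def by (simp add: infsumI)
qed

instantiation ell2 :: (type) real_inner
begin

definition inner_ell2 :: "'a ell2 \<Rightarrow> 'a ell2 \<Rightarrow> real" where "inner_ell2 x y = Re (cinner x y)"
definition norm_ell2 :: "'a ell2 \<Rightarrow> real" where "norm_ell2 x = sqrt (Re (cinner x x))"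
definition dist_ell2 :: "'a ell2 \<Rightarrow> 'a ell2 \<Rightarrow> real" where "dist_ell2 x y = norm (x - y)"
definition sgn_ell2 :: "'a ell2 \<Rightarrow> 'a ell2" where "sgn_ell2 x = x /\<^sub>R norm x"
definition uniformity_ell2 :: "('a ell2 \<times> 'a ell2) filter" where
  "uniformity_ell2 = (INF e\<in>{0 <..}. principal {(x, y). dist x y < e})"
definition open_ell2 :: "'a ell2 set \<Rightarrow> bool" where
  "open_ell2 U = (\<forall>x\<in>U. \<forall>\<^sub>F (x', y) in uniformity. x' = x \<longrightarrow> y \<in> U)"

instance
proof
  fix x y z :: "'a ell2" and r :: real
  show "inner x y = inner y x"
    unfolding inner_ell2_def by (subst cinner_commute) simp
  show "inner (x + y) z = inner x z + inner y z"
    by (simp add: inner_ell2_def cinner_add_left)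
  show "inner (r *\<^sub>R x) y = r * inner x y"
    by (simp add: inner_ell2_def scaleR_ell2_def cinner_scaleC_left)
  show "0 \<le> inner x x"
    by (simp add: inner_ell2_def cinner_self infsum_nonneg)
  show "inner x x = 0 \<longleftrightarrow> x = 0"
  proof
    assume "inner x x = 0"
    then have *: "(\<Sum>\<^sub>\<infinity>i. (cmod (ell2_apply x i))\<^sup>2) = 0" by (simp add: inner_ell2_def cinner_self)
    have "(cmod (ell2_apply x i))\<^sup>2 = 0" for i
      by (rule nonneg_infsum_le_0D[of _ UNIV]) (use * ell2_sq_summable in auto)
    then show "x = 0" by (intro ell2_eqI) (simp add: zero_ell2.rep_eq)
  next
    assume "x = 0"
    then show "inner x x = 0" by (simp add: inner_ell2_def cinner_self zero_ell2.rep_eq)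
  qed
qed (simp_all add: inner_ell2_def norm_ell2_def dist_ell2_def sgn_ell2_def uniformity_ell2_def
    open_ell2_def)

end

lemma norm_ell2_sq: "(norm x)\<^sup>2 = (\<Sum>\<^sub>\<infinity>i. (cmod (ell2_apply x i))\<^sup>2)"
  by (simp add: norm_ell2_def cinner_self infsum_nonneg)

lemma ell2_apply_minus: "ell2_apply (x - y) i = ell2_apply x i - ell2_apply y i"
  unfolding minus_ell2_def plus_ell2.rep_eq uminus_ell2.rep_eq by simp

lemma ell2_apply_scaleR: "ell2_apply (r *\<^sub>R x) i = complex_of_real r * ell2_apply x i"
  by (simp add: scaleR_ell2_def scaleC_ell2.rep_eq)

lemma ell2_finite_sum_le: "finite F \<Longrightarrow> (\<Sum>i\<in>F. (cmod (ell2_apply x i))\<^sup>2) \<le> (norm x)\<^sup>2"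
  unfolding norm_ell2_sq by (intro finite_sum_le_infsum ell2_sq_summable) auto

lemma ell2_coord_le: "cmod (ell2_apply x i) \<le> norm x"
  using ell2_finite_sum_le[of "{i}" x] by (simp add: power2_le_iff_abs_le)

lemma norm_scaleC_ell2: "norm (c *\<^sub>C x) = cmod c * norm (x :: 'i ell2)"
proof (rule power2_eq_imp_eq)
  show "(norm (c *\<^sub>C x))\<^sup>2 = (cmod c * norm x)\<^sup>2"
    unfolding power_mult_distrib norm_ell2_sq
    by (simp add: scaleC_ell2.rep_eq norm_mult power_mult_distrib infsum_cmult_right')
qed auto

instance ell2 :: (type) complete_space
proof
  fix X :: "nat \<Rightarrow> 'a ell2" assume X: "Cauchy X"
  have "Cauchy (\<lambda>n. ell2_apply (X n) i)" for i
  proof (rule metric_CauchyI)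
    fix e :: real assume "e > 0"
    then obtain M where "\<forall>m\<ge>M. \<forall>n\<ge>M. dist (X m) (X n) < e" using metric_CauchyD[OF X] by blast
    then show "\<exists>M. \<forall>m\<ge>M. \<forall>n\<ge>M. dist (ell2_apply (X m) i) (ell2_apply (X n) i) < e"
      using ell2_coord_le[of "X _ - X _" i]
      by (metis dist_norm ell2_apply_minus le_less_trans)
  qed
  then have "\<exists>l. (\<lambda>n. ell2_apply (X n) i) \<longlonglongrightarrow> l" for i
    by (simp add: Cauchy_convergent_iff convergent_def)
  then obtain f where f: "\<And>i. (\<lambda>n. ell2_apply (X n) i) \<longlonglongrightarrow> f i" by metis
  have bound: "(\<Sum>i\<in>F. (cmod (ell2_apply (X n) i - f i))\<^sup>2) \<le> e\<^sup>2"
    if F: "finite F" and n: "\<And>m. m \<ge> n \<Longrightarrow> dist (X n) (X m) \<le> e" for F n e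
  proof (rule LIMSEQ_le_const2)
    show "(\<lambda>m. \<Sum>i\<in>F. (cmod (ell2_apply (X n) i - ell2_apply (X m) i))\<^sup>2)
        \<longlonglongrightarrow> (\<Sum>i\<in>F. (cmod (ell2_apply (X n) i - f i))\<^sup>2)"
      by (intro tendsto_intros f)
    have "(\<Sum>i\<in>F. (cmod (ell2_apply (X n) i - ell2_apply (X m) i))\<^sup>2) \<le> e\<^sup>2" if "m \<ge> n" for m
    proof -
      have "(\<Sum>i\<in>F. (cmod (ell2_apply (X n) i - ell2_apply (X m) i))\<^sup>2) \<le> (norm (X n - X m))\<^sup>2"
        using ell2_finite_sum_le[OF F, of "X n - X m"] by (simp add: ell2_apply_minus)
      also have "\<dots> \<le> e\<^sup>2" using n[OF that] by (simp add: dist_norm power_mono)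
      finally show ?thesis .
    qed
    then show "\<exists>N. \<forall>m\<ge>N. (\<Sum>i\<in>F. (cmod (ell2_apply (X n) i - ell2_apply (X m) i))\<^sup>2) \<le> e\<^sup>2"
      by blast
  qed
  obtain N where N: "\<And>m. m \<ge> N \<Longrightarrow> dist (X N) (X m) \<le> 1"
    using metric_CauchyD[OF X, of 1] by (auto intro: less_imp_le)
  have "(\<lambda>i. (cmod (ell2_apply (X N) i - f i))\<^sup>2) summable_on UNIV"
    by (rule nonneg_bdd_above_summable_on)
       (auto intro!: bdd_aboveI2[where M = "1\<^sup>2"] bound[OF _ N])
  then have "(\<lambda>i. (cmod (- 1 * (ell2_apply (X N) i - f i)))\<^sup>2) summable_on UNIV"
    by (rule sq_summable_scale)
  then have "(\<lambda>i. (cmod (- 1 * (ell2_apply (X N) i - f i) + ell2_apply (X N) i))\<^sup>2) summable_on UNIV"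
    by (rule sq_summable_add[OF _ ell2_sq_summable])
  then have "(\<lambda>i. (cmod (f i))\<^sup>2) summable_on UNIV" by simp
  then obtain x where x: "f = ell2_apply x"
    by (metis Abs_ell2_inverse mem_Collect_eq)
  have "X \<longlonglongrightarrow> x"
  proof (rule metric_LIMSEQ_I)
    fix e :: real assume e: "e > 0"
    then obtain M where M: "\<And>m n. m \<ge> M \<Longrightarrow> n \<ge> M \<Longrightarrow> dist (X m) (X n) < e / 2"
      using metric_CauchyD[OF X, of "e / 2"] by auto
    have "dist (X n) x < e" if "n \<ge> M" for n
    proof -
      have "(norm (X n - x))\<^sup>2 \<le> (e / 2)\<^sup>2"
        unfolding norm_ell2_sq
      proof (rule infsum_le_finite_sums[OF ell2_sq_summable])
        fix F :: "'a set" assume "finite F"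
        then show "(\<Sum>i\<in>F. (cmod (ell2_apply (X n - x) i))\<^sup>2) \<le> (e / 2)\<^sup>2"
          using bound[of F n "e / 2"] less_imp_le[OF M[OF that]] that
          by (simp add: ell2_apply_minus x)
      qed
      then have "norm (X n - x) \<le> e / 2" using e by (simp add: power2_le_iff_abs_le)
      with e show ?thesis by (simp add: dist_norm)
    qed
    then show "\<exists>M. \<forall>n\<ge>M. dist (X n) x < e" by blast
  qed
  then show "convergent X" by (auto simp: convergent_def)
qed

instance ell2 :: (type) banach ..

text \<open>Boundedness of an operator is expressed over the reals by the library type of bounded linear
  maps; complex linearity is imposed on top.\<close>

typedef 'i bop = "{T :: 'i ell2 \<Rightarrow>\<^sub>L 'i ell2. \<forall>c x. T (c *\<^sub>C x) = c *\<^sub>C T x}"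
  morphisms bop_blinfun Abs_bop
  by (rule exI[of _ 0]) (auto intro: ell2_eqI simp: scaleC_ell2.rep_eq zero_ell2.rep_eq)

setup_lifting type_definition_bop

abbreviation bop_apply :: "'i bop \<Rightarrow> 'i ell2 \<Rightarrow> 'i ell2" where
  "bop_apply T \<equiv> blinfun_apply (bop_blinfun T)"


lemma bop_eqI: "(\<And>x. bop_apply S x = bop_apply T x) \<Longrightarrow> S = T"
  by (metis blinfun_eqI bop_blinfun_inject)

lemma bop_apply_scaleC: "bop_apply T (c *\<^sub>C x) = c *\<^sub>C bop_apply T x"
  using bop_blinfun[of T] by simp

lemma Re_cinner_self: "Re (cinner x x) = (norm x)\<^sup>2"
  by (simp add: norm_ell2_sq cinner_self)

lemma cinner_zero_right [simp]: "cinner x 0 = 0" and cinner_zero_left [simp]: "cinner 0 x = 0"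
  by (simp_all add: cinner_def zero_ell2.rep_eq)

lemma cinner_cauchy_schwarz: "cmod (cinner x y) \<le> norm x * norm y"
proof (cases "cinner x y = 0")
  case False
  define c where "c = cnj (cinner x y) / cmod (cinner x y)"
  have c: "cmod c = 1" using False by (simp add: c_def norm_divide)
  have "cnj (cinner x y) * cinner x y = cmod (cinner x y) * cmod (cinner x y)"
    by (metis complex_norm_square mult.commute power2_eq_square)
  then have "c * cinner x y = cmod (cinner x y)"
    using False by (simp add: c_def)
  then have "cmod (cinner x y) = inner x (c *\<^sub>C y)"
    by (simp add: inner_ell2_def cinner_scaleC_right)
  also have "\<dots> \<le> norm x * norm (c *\<^sub>C y)" by (rule norm_cauchy_schwarz)
  finally show ?thesis by (simp add: norm_scaleC_ell2 c)
qed simp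

lemma cinner_eqI: "(\<And>y. cinner x y = cinner x' y) \<Longrightarrow> x = x'"
proof -
  assume "\<And>y. cinner x y = cinner x' y"
  then have "inner (x - x') (x - x') = 0"
    by (metis inner_diff_left inner_ell2_def diff_self)
  then show ?thesis by simp
qed

lift_definition ell2_basis :: "'i \<Rightarrow> 'i ell2" is "\<lambda>i j. if j = i then 1 else 0"
  by (rule finite_nonzero_values_imp_summable_on) auto

lemma ell2_apply_sum: "ell2_apply (\<Sum>i\<in>F. f i) j = (\<Sum>i\<in>F. ell2_apply (f i) j)"
  by (induction F rule: infinite_finite_induct) (auto simp: zero_ell2.rep_eq plus_ell2.rep_eq)

lemma ell2_apply_basis_sum:
  "finite F \<Longrightarrow> ell2_apply (\<Sum>i\<in>F. f i *\<^sub>C ell2_basis i) j = (if j \<in> F then f j else 0)"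
  by (simp add: ell2_apply_sum scaleC_ell2.rep_eq ell2_basis.rep_eq if_distrib cong: if_cong)

lemma norm_basis_sum:
  assumes "finite F"
  shows "(norm (\<Sum>i\<in>F. f i *\<^sub>C ell2_basis i))\<^sup>2 = (\<Sum>i\<in>F. (cmod (f i))\<^sup>2)"
proof -
  have "(norm (\<Sum>i\<in>F. f i *\<^sub>C ell2_basis i))\<^sup>2 = (\<Sum>\<^sub>\<infinity>i\<in>F. (cmod (f i))\<^sup>2)"
    unfolding norm_ell2_sq ell2_apply_basis_sum[OF assms]
    by (rule infsum_cong_neutral) auto
  with assms show ?thesis by simp
qed

lemma ell2_basis_has_sum: "((\<lambda>i. ell2_apply x i *\<^sub>C ell2_basis i) has_sum x) UNIV"
  unfolding has_sum_def
proof (rule tendstoI)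
  fix e :: real assume e: "e > 0"
  let ?g = "\<lambda>i. (cmod (ell2_apply x i))\<^sup>2"
  have "(?g has_sum (norm x)\<^sup>2) UNIV"
    unfolding norm_ell2_sq by (rule has_sum_infsum[OF ell2_sq_summable])
  then obtain X where X: "finite X" "\<And>Y. finite Y \<Longrightarrow> X \<subseteq> Y \<Longrightarrow> dist (sum ?g Y) ((norm x)\<^sup>2) < e\<^sup>2"
    using e unfolding has_sum_def tendsto_iff eventually_finite_subsets_at_top
    by (metis subset_UNIV zero_less_power)
  have "dist (\<Sum>i\<in>Y. ell2_apply x i *\<^sub>C ell2_basis i) x < e" if Y: "finite Y" "X \<subseteq> Y" for Y
  proof -
    let ?s = "\<Sum>i\<in>Y. ell2_apply x i *\<^sub>C ell2_basis i"
    have "(norm (x - ?s))\<^sup>2 = (\<Sum>\<^sub>\<infinity>i\<in>UNIV - Y. ?g i)"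
      unfolding norm_ell2_sq ell2_apply_minus ell2_apply_basis_sum[OF Y(1)]
      by (rule infsum_cong_neutral) auto
    also have "\<dots> = (\<Sum>\<^sub>\<infinity>i. ?g i) - (\<Sum>\<^sub>\<infinity>i\<in>Y. ?g i)"
      by (rule infsum_Diff) (use Y(1) ell2_sq_summable in auto)
    also have "\<dots> = (norm x)\<^sup>2 - sum ?g Y" using Y(1) by (simp add: norm_ell2_sq)
    also have "\<dots> < e\<^sup>2" using X(2)[OF Y] by (auto simp: dist_real_def)
    finally show ?thesis using e by (simp add: dist_norm norm_minus_commute power2_less_imp_less)
  qed
  with X(1) show "\<forall>\<^sub>F Y in finite_subsets_at_top UNIV.
      dist (\<Sum>i\<in>Y. ell2_apply x i *\<^sub>C ell2_basis i) x < e"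
    unfolding eventually_finite_subsets_at_top by blast
qed

lemma cinner_diff_left: "cinner (x - y) z = cinner x z - cinner y z"
  using cinner_add_left[of "x - y" y z] by simp

lemma cinner_sum_left: "cinner (\<Sum>i\<in>F. f i) z = (\<Sum>i\<in>F. cinner (f i) z)"
  by (induction F rule: infinite_finite_induct) (auto simp: cinner_add_left)

lemma ex_adjoint_vec: "\<exists>z. \<forall>x. cinner (bop_apply T x) y = cinner x z"
proof -
  define g where "g i = cinner (bop_apply T (ell2_basis i)) y" for i
  let ?K = "norm (bop_blinfun T) * norm y"
  have "(\<Sum>i\<in>F. (cmod (g i))\<^sup>2) \<le> ?K\<^sup>2" if F: "finite F" for F
  proof -
    let ?w = "\<Sum>i\<in>F. g i *\<^sub>C ell2_basis i"
    let ?s = "\<Sum>i\<in>F. (cmod (g i))\<^sup>2"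
    have "cinner (bop_apply T ?w) y = (\<Sum>i\<in>F. cnj (g i) * g i)"
      by (simp add: blinfun.sum_right cinner_sum_left bop_apply_scaleC cinner_scaleC_left g_def)
    also have "\<dots> = complex_of_real ?s"
      by (simp only: complex_norm_square mult.commute of_real_sum)
    finally have "cinner (bop_apply T ?w) y = complex_of_real ?s" .
    moreover have "0 \<le> ?s" by (simp add: sum_nonneg)
    ultimately have "?s = cmod (cinner (bop_apply T ?w) y)"
      by (simp only: norm_of_real abs_of_nonneg)
    also have "\<dots> \<le> norm (bop_apply T ?w) * norm y" by (rule cinner_cauchy_schwarz)
    also have "\<dots> \<le> (norm (bop_blinfun T) * norm ?w) * norm y"
      by (intro mult_right_mono norm_blinfun) auto
    finally have le: "(norm ?w)\<^sup>2 \<le> ?K * norm ?w"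
      by (simp add: norm_basis_sum[OF F] mult_ac)
    have "norm ?w \<le> ?K"
    proof (cases "norm ?w = 0")
      case False
      with le show ?thesis by (simp add: power2_eq_square)
    qed (metis mult_nonneg_nonneg norm_ge_zero)
    then have "(norm ?w)\<^sup>2 \<le> ?K\<^sup>2" by (intro power_mono) auto
    then show ?thesis by (simp add: norm_basis_sum[OF F])
  qed
  then have "(\<lambda>i. (cmod (g i))\<^sup>2) summable_on UNIV"
    by (intro nonneg_bdd_above_summable_on) (auto intro!: bdd_aboveI2)
  then obtain z where z: "g = ell2_apply z" by (metis Abs_ell2_inverse mem_Collect_eq)
  have "cinner (bop_apply T x) y = cinner x z" for x
  proof -
    have "bounded_linear (\<lambda>x. cinner (bop_apply T x) y)"
    proof (rule bounded_linear_intro[where K = ?K])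
      fix x x' and r :: real
      show "cinner (bop_apply T (x + x')) y = cinner (bop_apply T x) y + cinner (bop_apply T x') y"
        by (simp add: blinfun.add_right cinner_add_left)
      show "cinner (bop_apply T (r *\<^sub>R x)) y = r *\<^sub>R cinner (bop_apply T x) y"
        by (simp add: scaleR_ell2_def bop_apply_scaleC cinner_scaleC_left scaleR_conv_of_real)
      have "cmod (cinner (bop_apply T x) y) \<le> norm (bop_apply T x) * norm y"
        by (rule cinner_cauchy_schwarz)
      also have "\<dots> \<le> (norm (bop_blinfun T) * norm x) * norm y"
        by (intro mult_right_mono norm_blinfun) auto
      finally show "cmod (cinner (bop_apply T x) y) \<le> norm x * ?K" by (simp add: mult_ac)
    qed
    from has_sum_bounded_linear[OF this ell2_basis_has_sum]
    have "((\<lambda>i. cinner (bop_apply T (ell2_apply x i *\<^sub>C ell2_basis i)) y) has_sum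
        cinner (bop_apply T x) y) UNIV"
      by (simp add: o_def)
    then have "((\<lambda>i. cnj (ell2_apply x i) * ell2_apply z i) has_sum cinner (bop_apply T x) y) UNIV"
      by (simp add: bop_apply_scaleC cinner_scaleC_left g_def flip: z)
    then show ?thesis by (simp add: cinner_def infsumI)
  qed
  then show ?thesis by blast
qed

lemma ex_adjoint: "\<exists>S :: 'i bop. \<forall>x y. cinner (bop_apply S x) y = cinner x (bop_apply T y)"
proof -
  obtain S where S: "\<And>x y. cinner (bop_apply T y) x = cinner y (S x)"
    using ex_adjoint_vec by metis
  have S': "cinner (S x) y = cinner x (bop_apply T y)" for x y
    by (metis S cinner_commute)
  have lin: "S (x + x') = S x + S x'" "S (c *\<^sub>C x) = c *\<^sub>C S x" for x x' c
    by (rule cinner_eqI; simp add: S' cinner_add_left cinner_scaleC_left)+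
  have bd: "norm (S x) \<le> norm x * norm (bop_blinfun T)" for x
  proof -
    have "(norm (S x))\<^sup>2 = Re (cinner x (bop_apply T (S x)))" by (simp flip: Re_cinner_self S')
    also have "\<dots> \<le> cmod (cinner x (bop_apply T (S x)))" by (rule complex_Re_le_cmod)
    also have "\<dots> \<le> norm x * norm (bop_apply T (S x))" by (rule cinner_cauchy_schwarz)
    also have "\<dots> \<le> norm x * (norm (bop_blinfun T) * norm (S x))"
      by (intro mult_left_mono norm_blinfun) auto
    finally have "norm (S x) * norm (S x) \<le> (norm x * norm (bop_blinfun T)) * norm (S x)"
      by (simp add: power2_eq_square mult_ac)
    then show ?thesis
      by (cases "norm (S x) = 0") (auto simp: mult_le_cancel_right)
  qed
  have bl: "bounded_linear S"
    by (rule bounded_linear_intro[OF _ _ bd]) (auto simp: lin scaleR_ell2_def)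
  then have "bop_blinfun (Abs_bop (Blinfun S)) = Blinfun S"
    by (intro Abs_bop_inverse) (simp add: bounded_linear_Blinfun_apply lin)
  with bl have "bop_apply (Abs_bop (Blinfun S)) = S"
    by (simp add: bounded_linear_Blinfun_apply)
  with S' show ?thesis by (intro exI[of _ "Abs_bop (Blinfun S)"]) simp
qed

lemma scaleC_bop_aux: "bounded_linear (\<lambda>x :: 'a ell2. c *\<^sub>C blinfun_apply T x :: 'a ell2)"
proof (rule bounded_linear_intro[where K = "cmod c * norm T"])
  fix x :: "'a ell2"
  show "norm (c *\<^sub>C blinfun_apply T x) \<le> norm x * (cmod c * norm T)"
    using mult_left_mono[OF norm_blinfun[of T x], of "cmod c"]
    by (simp add: norm_scaleC_ell2 mult_ac)
qed (auto intro!: ell2_eqI simp: blinfun.add_right blinfun.scaleR_right scaleC_ell2.rep_eq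
    plus_ell2.rep_eq ell2_apply_scaleR algebra_simps)

instantiation bop :: (type) "{zero, one, plus, uminus, minus, times, scaleR, scaleC, star}"
begin

lift_definition zero_bop :: "'a bop" is 0
  by (auto intro: ell2_eqI simp: scaleC_ell2.rep_eq zero_ell2.rep_eq)
lift_definition one_bop :: "'a bop" is id_blinfun by simp
lift_definition plus_bop :: "'a bop \<Rightarrow> 'a bop \<Rightarrow> 'a bop" is "(+)"
  by (auto intro: ell2_eqI simp: blinfun.add_left scaleC_ell2.rep_eq plus_ell2.rep_eq algebra_simps)
lift_definition uminus_bop :: "'a bop \<Rightarrow> 'a bop" is uminus
  by (auto intro: ell2_eqI simp: blinfun.minus_left scaleC_ell2.rep_eq uminus_ell2.rep_eq)
definition minus_bop :: "'a bop \<Rightarrow> 'a bop \<Rightarrow> 'a bop" where "minus_bop S T = S + - T"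
lift_definition times_bop :: "'a bop \<Rightarrow> 'a bop \<Rightarrow> 'a bop" is "(o\<^sub>L)" by simp
lift_definition scaleR_bop :: "real \<Rightarrow> 'a bop \<Rightarrow> 'a bop" is "(*\<^sub>R)"
  by (auto intro: ell2_eqI simp: blinfun.scaleR_left scaleR_ell2_def scaleC_ell2.rep_eq)
lift_definition scaleC_bop :: "complex \<Rightarrow> 'a bop \<Rightarrow> 'a bop" is
  "\<lambda>c T. Blinfun (\<lambda>x. c *\<^sub>C blinfun_apply T x)"
  by (auto intro!: ell2_eqI simp: bounded_linear_Blinfun_apply[OF scaleC_bop_aux] scaleC_ell2.rep_eq)
definition star_bop :: "'a bop \<Rightarrow> 'a bop" where
  "star_bop T = (THE S. \<forall>x y. cinner (bop_apply S x) y = cinner x (bop_apply T y))"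

instance ..

end

lemma cinner_star: "cinner (bop_apply (star T) x) y = cinner x (bop_apply (T :: 'a bop) y)"
proof -
  obtain S where S: "\<forall>x y. cinner (bop_apply S x) y = cinner x (bop_apply T y)"
    using ex_adjoint by blast
  have "\<forall>x y. cinner (bop_apply (star T) x) y = cinner x (bop_apply T y)"
    unfolding star_bop_def
  proof (rule theI[where a = S], rule S)
    fix S' assume "\<forall>x y. cinner (bop_apply S' x) y = cinner x (bop_apply T y)"
    then have "cinner (bop_apply S' x) y = cinner (bop_apply S x) y" for x y by (simp only: S)
    then show "S' = S" by (intro bop_eqI cinner_eqI)
  qed
  then show ?thesis by blast
qed

lemma bop_blinfun_minus: "bop_blinfun (S - T) = bop_blinfun S - bop_blinfun T"
  by (simp add: minus_bop_def plus_bop.rep_eq uminus_bop.rep_eq)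

lemma bop_apply_simps:
  "bop_apply 0 x = 0" "bop_apply 1 x = x" "bop_apply (S + T) x = bop_apply S x + bop_apply T x"
  "bop_apply (- S) x = - bop_apply S x" "bop_apply (S - T) x = bop_apply S x - bop_apply T x"
  "bop_apply (S * T) x = bop_apply S (bop_apply T x)" "bop_apply (r *\<^sub>R S) x = r *\<^sub>R bop_apply S x"
  "bop_apply (c *\<^sub>C S) x = c *\<^sub>C bop_apply S x"
  by (simp_all add: zero_bop.rep_eq one_bop.rep_eq plus_bop.rep_eq uminus_bop.rep_eq bop_blinfun_minus
      times_bop.rep_eq scaleR_bop.rep_eq scaleC_bop.rep_eq blinfun.add_left blinfun.minus_left
      blinfun.scaleR_left blinfun.diff_left bounded_linear_Blinfun_apply[OF scaleC_bop_aux])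

lemma ell2_scaleC_simps:
  "c *\<^sub>C (x + y) = c *\<^sub>C x + c *\<^sub>C (y :: 'i ell2)" "(c + d) *\<^sub>C x = c *\<^sub>C x + d *\<^sub>C x"
  "c *\<^sub>C d *\<^sub>C x = (c * d) *\<^sub>C x"
  by (rule ell2_eqI; simp add: scaleC_ell2.rep_eq plus_ell2.rep_eq algebra_simps)+

lemma star_star_bop: "star (star T) = (T :: 'a bop)"
  by (intro bop_eqI cinner_eqI) (metis cinner_star cinner_commute)

instantiation bop :: (type) real_normed_algebra_1
begin

lift_definition norm_bop :: "'a bop \<Rightarrow> real" is norm .
definition dist_bop :: "'a bop \<Rightarrow> 'a bop \<Rightarrow> real" where "dist_bop S T = norm (S - T)"
definition sgn_bop :: "'a bop \<Rightarrow> 'a bop" where "sgn_bop T = T /\<^sub>R norm T"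
definition uniformity_bop :: "('a bop \<times> 'a bop) filter" where
  "uniformity_bop = (INF e\<in>{0 <..}. principal {(x, y). dist x y < e})"
definition open_bop :: "'a bop set \<Rightarrow> bool" where
  "open_bop U = (\<forall>x\<in>U. \<forall>\<^sub>F (x', y) in uniformity. x' = x \<longrightarrow> y \<in> U)"

lemma norm_bop_apply: "norm (bop_apply T x) \<le> norm (T :: 'a bop) * norm x"
  unfolding norm_bop.rep_eq by (rule norm_blinfun)

lemma norm_bop_bound: "0 \<le> b \<Longrightarrow> (\<And>x. norm (bop_apply T x) \<le> b * norm x) \<Longrightarrow> norm (T :: 'a bop) \<le> b"
  unfolding norm_bop.rep_eq by (rule norm_blinfun_bound)

lemma norm_bop_mult: "norm (S * T) \<le> norm S * norm (T :: 'a bop)"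
proof (rule norm_bop_bound)
  fix x
  have "norm (bop_apply (S * T) x) \<le> norm S * norm (bop_apply T x)"
    by (simp add: bop_apply_simps norm_bop_apply)
  also have "\<dots> \<le> norm S * (norm T * norm x)"
    by (intro mult_left_mono norm_bop_apply) (simp add: norm_bop.rep_eq)
  finally show "norm (bop_apply (S * T) x) \<le> norm S * norm T * norm x" by (simp add: mult_ac)
qed (simp add: norm_bop.rep_eq)

lemma norm_bop_ge_0: "0 \<le> norm (T :: 'a bop)"
  by (simp add: norm_bop.rep_eq)

lemma norm_bop_sq_le: "(norm T)\<^sup>2 \<le> norm (star T * T :: 'a bop)"
proof -
  have "norm T \<le> sqrt (norm (star T * T))"
  proof (rule norm_bop_bound)
    fix x
    have "(norm (bop_apply T x))\<^sup>2 = Re (cinner (bop_apply (star T * T) x) x)"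
      by (simp add: bop_apply_simps cinner_star Re_cinner_self)
    also have "\<dots> \<le> cmod (cinner (bop_apply (star T * T) x) x)" by (rule complex_Re_le_cmod)
    also have "\<dots> \<le> norm (bop_apply (star T * T) x) * norm x" by (rule cinner_cauchy_schwarz)
    also have "\<dots> \<le> (norm (star T * T) * norm x) * norm x"
      by (intro mult_right_mono norm_bop_apply) auto
    also have "\<dots> = (sqrt (norm (star T * T)) * norm x)\<^sup>2"
      by (simp add: power_mult_distrib norm_bop_ge_0 power2_eq_square)
    finally show "norm (bop_apply T x) \<le> sqrt (norm (star T * T)) * norm x"
      by (rule power2_le_imp_le) (simp add: norm_bop_ge_0)
  qed (simp add: norm_bop_ge_0)
  then show ?thesis
    by (metis norm_bop_ge_0 power_mono real_sqrt_pow2)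
qed

lemma norm_bop_star: "norm (star T) = norm (T :: 'a bop)"
proof -
  have le: "norm T \<le> norm (star T)" for T :: "'a bop"
  proof (cases "norm T = 0")
    case False
    have "norm T * norm T \<le> norm (star T) * norm T"
      using norm_bop_sq_le[of T] norm_bop_mult[of "star T" T] by (simp add: power2_eq_square)
    with False norm_bop_ge_0[of T] show ?thesis by (simp add: mult_le_cancel_right)
  qed (simp add: norm_bop_ge_0)
  from le[of T] le[of "star T"] show ?thesis by (simp add: star_star_bop)
qed

instance
proof
  fix S T U :: "'a bop" and r s :: real
  show "S + T + U = S + (T + U)" "S + T = T + S" "0 + S = S" "- S + S = 0" "S - T = S + - T"
    "r *\<^sub>R (S + T) = r *\<^sub>R S + r *\<^sub>R T" "(r + s) *\<^sub>R S = r *\<^sub>R S + s *\<^sub>R S"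
    "r *\<^sub>R s *\<^sub>R S = (r * s) *\<^sub>R S" "1 *\<^sub>R S = S"
    "S * T * U = S * (T * U)" "(S + T) * U = S * U + T * U" "S * (T + U) = S * T + S * U"
    "1 * S = S" "S * 1 = S" "r *\<^sub>R S * T = r *\<^sub>R (S * T)" "S * r *\<^sub>R T = r *\<^sub>R (S * T)"
    by (rule bop_eqI; simp add: bop_apply_simps algebra_simps blinfun.add_right
        blinfun.scaleR_right)+
  show "(0 :: 'a bop) \<noteq> 1"
  proof
    assume "(0 :: 'a bop) = 1"
    then have "ell2_basis (undefined :: 'a) = 0" by (metis bop_apply_simps(1,2))
    then have "ell2_apply (ell2_basis (undefined :: 'a)) undefined = 0"
      by (simp add: zero_ell2.rep_eq)
    then show False by (simp add: ell2_basis.rep_eq)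
  qed
  show "dist S T = norm (S - T)" "sgn S = S /\<^sub>R norm S"
    "(uniformity :: ('a bop \<times> 'a bop) filter) = (INF e\<in>{0 <..}. principal {(x, y). dist x y < e})"
    by (rule dist_bop_def sgn_bop_def uniformity_bop_def)+
  show "open V = (\<forall>x\<in>V. \<forall>\<^sub>F (x', y) in uniformity. x' = x \<longrightarrow> y \<in> V)" for V :: "'a bop set"
    by (rule open_bop_def)
  show "norm S = 0 \<longleftrightarrow> S = 0"
    by (simp add: norm_bop.rep_eq zero_bop.rep_eq flip: bop_blinfun_inject)
  show "norm (S + T) \<le> norm S + norm T"
    by (simp add: norm_bop.rep_eq plus_bop.rep_eq norm_triangle_ineq)
  show "norm (r *\<^sub>R S) = \<bar>r\<bar> * norm S"
    by (simp add: norm_bop.rep_eq scaleR_bop.rep_eq)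
  show "norm (S * T) \<le> norm S * norm T" by (rule norm_bop_mult)
  show "norm (1 :: 'a bop) = 1"
  proof (rule antisym)
    show "norm (1 :: 'a bop) \<le> 1" by (rule norm_bop_bound) (simp_all add: bop_apply_simps)
    let ?e = "ell2_basis (undefined :: 'a)"
    have "norm ?e * norm ?e = 1"
      using norm_basis_sum[of "{undefined}" "\<lambda>_. 1"]
      by (simp add: power2_eq_square norm_scaleC_ell2)
    then have "norm ?e = 1" by (metis norm_ge_zero power2_eq_square power2_eq_1_iff zero_le_one
          neg_0_le_iff_le not_one_le_zero)
    then show "1 \<le> norm (1 :: 'a bop)" using norm_bop_apply[of 1 ?e] by (simp add: bop_apply_simps)
  qed
qed

end

instance bop :: (type) complete_space
proof
  fix X :: "nat \<Rightarrow> 'a bop" assume X: "Cauchy X"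
  have dist: "dist S T = dist (bop_blinfun S) (bop_blinfun T)" for S T :: "'a bop"
    by (simp add: dist_bop_def norm_bop.rep_eq bop_blinfun_minus dist_norm)
  have "Cauchy (\<lambda>n. bop_blinfun (X n))"
    using X by (simp add: Cauchy_def dist)
  then obtain L where L: "(\<lambda>n. bop_blinfun (X n)) \<longlonglongrightarrow> L"
    by (auto simp: Cauchy_convergent_iff convergent_def)
  have ap: "(\<lambda>n. bop_apply (X n) x) \<longlonglongrightarrow> blinfun_apply L x" for x
    by (intro tendsto_intros L)
  have "blinfun_apply L (c *\<^sub>C x) = c *\<^sub>C blinfun_apply L x" for c x
  proof (rule LIMSEQ_unique[OF ap])
    have "bounded_linear (scaleC c :: 'a ell2 \<Rightarrow> 'a ell2)"
      using scaleC_bop_aux[of c id_blinfun] by simp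
    from bounded_linear.tendsto[OF this ap]
    show "(\<lambda>n. bop_apply (X n) (c *\<^sub>C x)) \<longlonglongrightarrow> c *\<^sub>C blinfun_apply L x"
      by (simp add: bop_apply_scaleC)
  qed
  then have "bop_blinfun (Abs_bop L) = L" by (intro Abs_bop_inverse) simp
  with L have "X \<longlonglongrightarrow> Abs_bop L" by (simp add: lim_sequentially dist)
  then show "convergent X" by (auto simp: convergent_def)
qed

instance bop :: (type) cstar_algebra
proof
  fix S T :: "'a bop" and r :: real and c d :: complex
  show "c *\<^sub>C (S + T) = c *\<^sub>C S + c *\<^sub>C T" "(c + d) *\<^sub>C S = c *\<^sub>C S + d *\<^sub>C S"
    "c *\<^sub>C d *\<^sub>C S = (c * d) *\<^sub>C S" "r *\<^sub>R S = complex_of_real r *\<^sub>C S"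
    "c *\<^sub>C S * T = c *\<^sub>C (S * T)" "S * c *\<^sub>C T = c *\<^sub>C (S * T)"
    by (rule bop_eqI; simp add: bop_apply_simps ell2_scaleC_simps bop_apply_scaleC
        scaleR_ell2_def)+
  show "star (star S) = S" by (rule star_star_bop)
  show "star (S + T) = star S + star T" "star (c *\<^sub>C S) = cnj c *\<^sub>C star S"
    "star (S * T) = star T * star S"
    by (intro bop_eqI cinner_eqI; simp add: cinner_star bop_apply_simps cinner_add_left
        cinner_add_right cinner_scaleC_left cinner_scaleC_right)+
  show "norm (c *\<^sub>C S) = cmod c * norm S"
  proof (cases "c = 0")
    case True
    then have "c *\<^sub>C S = 0"
      by (intro bop_eqI ell2_eqI) (simp add: bop_apply_simps scaleC_ell2.rep_eq zero_ell2.rep_eq)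
    with True show ?thesis by (simp add: norm_bop.rep_eq zero_bop.rep_eq)
  next
    case False
    have le: "norm (c *\<^sub>C S) \<le> cmod c * norm S" for c and S :: "'a bop"
    proof (rule norm_bop_bound)
      fix x
      show "norm (bop_apply (c *\<^sub>C S) x) \<le> cmod c * norm S * norm x"
        using mult_left_mono[OF norm_bop_apply[of S x], of "cmod c"]
        by (simp add: bop_apply_simps norm_scaleC_ell2 mult_ac)
    qed (simp add: norm_bop_ge_0)
    have "inverse c *\<^sub>C c *\<^sub>C S = S"
      using False by (intro bop_eqI ell2_eqI) (simp add: bop_apply_simps scaleC_ell2.rep_eq)
    with le[of "inverse c" "c *\<^sub>C S"] False have "cmod c * norm S \<le> norm (c *\<^sub>C S)"
      by (simp add: norm_inverse norm_divide field_simps)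
    with le[of c S] show ?thesis by simp
  qed
  show "norm (star S * S) = (norm S)\<^sup>2"
    using norm_bop_sq_le[of S] norm_bop_mult[of "star S" S]
    by (simp add: norm_bop_star power2_eq_square)
qed


section \<open>Spatial tensor products\<close>

lift_definition ell2_tensor :: "'i ell2 \<Rightarrow> 'j ell2 \<Rightarrow> ('i \<times> 'j) ell2" is
  "\<lambda>f g (i, j). f i * g j"
proof -
  fix f :: "'i \<Rightarrow> complex" and g :: "'j \<Rightarrow> complex"
  assume f: "(\<lambda>i. (cmod (f i))\<^sup>2) summable_on UNIV" and g: "(\<lambda>j. (cmod (g j))\<^sup>2) summable_on UNIV"
  let ?h = "\<lambda>(i, j). (f i)\<^sup>2 * (g j)\<^sup>2"
  have "(\<lambda>p. norm (?h p)) summable_on (UNIV \<times> UNIV)"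
    by (rule Infinite_Sum.abs_summable_on_Sigma_iff[THEN iffD2])
       (use f g in \<open>auto simp: norm_mult norm_power infsum_cmult_right' infsum_nonneg
          intro: summable_on_cmult_right summable_on_cmult_left\<close>)
  then show "(\<lambda>i. (cmod (case i of (i, j) \<Rightarrow> f i * g j))\<^sup>2) summable_on UNIV"
    by (simp add: case_prod_beta norm_mult norm_power power_mult_distrib)
qed

text \<open>\<open>tens\<close> exhibits its codomain \<open>'t\<close> as the spatial (minimal) tensor product of \<open>'a\<close> and \<open>'b\<close>:
  for some faithful representations of the factors, \<open>'t\<close> is the closed linear span of the elementary
  tensors, acting on the Hilbert space tensor product \<open>\<ell>\<^sup>2('a) \<otimes> \<ell>\<^sup>2('b) = \<ell>\<^sup>2('a \<times> 'b)\<close>. Every C*-algebra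
  has a faithful representation on a Hilbert space with an orthonormal basis indexed by its own
  elements, and \<open>'t\<close> does not depend on the choice of the representations. The elementary tensors are
  stable under complex scalars, so their real linear span is already a complex subspace.\<close>

definition spatial_tensor_product ::
    "('a::cstar_algebra \<Rightarrow> 'b::cstar_algebra \<Rightarrow> 't::cstar_algebra) \<Rightarrow> bool" where
  "spatial_tensor_product tens \<longleftrightarrow>
     closure (span {tens x y |x y. True}) = UNIV \<and>
     (\<exists>(\<pi> :: 'a \<Rightarrow> 'a bop) (\<rho> :: 'b \<Rightarrow> 'b bop) (\<sigma> :: 't \<Rightarrow> ('a \<times> 'b) bop).
        star_hom \<pi> \<and> (\<forall>x. norm (\<pi> x) = norm x) \<and>
        star_hom \<rho> \<and> (\<forall>y. norm (\<rho> y) = norm y) \<and>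
        star_hom \<sigma> \<and> (\<forall>z. norm (\<sigma> z) = norm z) \<and>
        (\<forall>x y u v. bop_apply (\<sigma> (tens x y)) (ell2_tensor u v) =
           ell2_tensor (bop_apply (\<pi> x) u) (bop_apply (\<rho> y) v)))"

text \<open>The continuous linear map \<open>f \<otimes> g\<close>, from the tensor product given by \<open>tens\<close> to the one given by
  \<open>tens'\<close>. Taking \<open>tens'\<close> to be scalar multiplication (that is, \<open>\<complex> \<otimes> 'b = 'b\<close>) gives slice maps.\<close>

definition tensor_map ::
    "('a::cstar_algebra \<Rightarrow> 'b::cstar_algebra \<Rightarrow> 't::cstar_algebra) \<Rightarrow>
     ('c \<Rightarrow> 'd \<Rightarrow> 'u::cstar_algebra) \<Rightarrow> ('a \<Rightarrow> 'c) \<Rightarrow> ('b \<Rightarrow> 'd) \<Rightarrow> 't \<Rightarrow> 'u" where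
  "tensor_map tens tens' f g =
     (THE F. bounded_linear F \<and> (\<forall>x y. F (tens x y) = tens' (f x) (g y)))"


section \<open>Conditional expectations of index-finite type\<close>

text \<open>A contractive \<open>B\<close>-bimodule projection onto \<open>B\<close>; it is positive by Tomiyama's theorem.\<close>

definition conditional_expectation ::
    "'a::cstar_algebra set \<Rightarrow> ('a \<Rightarrow> 'a) \<Rightarrow> bool" where
  "conditional_expectation B E \<longleftrightarrow>
     cstar_subalgebra B \<and>
     (\<forall>x y. E (x + y) = E x + E y) \<and> (\<forall>c x. E (c *\<^sub>C x) = c *\<^sub>C E x) \<and>
     (\<forall>x. E x \<in> B) \<and> (\<forall>b\<in>B. E b = b) \<and> (\<forall>x. norm (E x) \<le> norm x) \<and>
     (\<forall>b\<in>B. \<forall>x. E (b * x) = b * E x \<and> E (x * b) = E x * b)"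

definition quasi_basis ::
    "('a::cstar_algebra \<Rightarrow> 'a) \<Rightarrow> nat \<Rightarrow> (nat \<Rightarrow> 'a) \<Rightarrow> (nat \<Rightarrow> 'a) \<Rightarrow> bool" where
  "quasi_basis E n u v \<longleftrightarrow>
     (\<forall>x. x = (\<Sum>j=1..n. u j * E (v j * x)) \<and> x = (\<Sum>j=1..n. E (x * u j) * v j))"

definition index_finite_type :: "('a::cstar_algebra \<Rightarrow> 'a) \<Rightarrow> bool" where
  "index_finite_type E \<longleftrightarrow> (\<exists>n u v. quasi_basis E n u v)"

text \<open>The first conjunct records that the notion is only meant for conditional expectations.\<close>

definition infinite_watatani_index :: "'a::cstar_algebra set \<Rightarrow> ('a \<Rightarrow> 'a) \<Rightarrow> bool" where
  "infinite_watatani_index B E \<longleftrightarrow> conditional_expectation B E \<and> \<not> index_finite_type E"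


section \<open>The quantum group \<open>U\<^sub>q(2)\<close>\<close>

definition uq2_relations :: "complex \<Rightarrow> 'a::cstar_algebra \<Rightarrow> 'a \<Rightarrow> 'a \<Rightarrow> bool" where
  "uq2_relations q a b D \<longleftrightarrow>
     b * a = q *\<^sub>C (a * b) \<and>
     star a * b = q *\<^sub>C (b * star a) \<and>
     b * star b = star b * b \<and>
     a * star a + b * star b = 1 \<and>
     a * D = D * a \<and>
     b * D = (q\<^sup>2 / (complex_of_real (cmod q))\<^sup>2) *\<^sub>C (D * b) \<and>
     D * star D = 1 \<and> star D * D = 1 \<and>
     star a * a + (cmod q)\<^sup>2 *\<^sub>R (star b * b) = 1"

text \<open>\<open>'a\<close> is the universal unital C*-algebra \<open>C(U\<^sub>q(2))\<close> with generators \<open>a\<close>, \<open>b\<close>, \<open>D\<close>. Universality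
  is stated for families of operators on \<open>\<ell>\<^sup>2(\<nat>)\<close> satisfying the relations; this is universality for
  all unital C*-algebras, because three elements generate a separable C*-subalgebra, and that
  embeds unitally into the operators on \<open>\<ell>\<^sup>2(\<nat>)\<close>.\<close>

definition is_C_Uq2 :: "complex \<Rightarrow> 'a::cstar_algebra \<Rightarrow> 'a \<Rightarrow> 'a \<Rightarrow> bool" where
  "is_C_Uq2 q a b D \<longleftrightarrow>
     uq2_relations q a b D \<and> cstar_generates {a, b, D} \<and>
     (\<forall>a' b' D' :: nat bop. uq2_relations q a' b' D' \<longrightarrow>
        (\<exists>\<pi> :: 'a \<Rightarrow> nat bop. star_hom \<pi> \<and> \<pi> a = a' \<and> \<pi> b = b' \<and> \<pi> D = D'))"

definition uq2_comultiplication ::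
    "complex \<Rightarrow> 'a::cstar_algebra \<Rightarrow> 'a \<Rightarrow> 'a \<Rightarrow> ('a \<Rightarrow> 'a \<Rightarrow> 't::cstar_algebra) \<Rightarrow> ('a \<Rightarrow> 't) \<Rightarrow> bool" where
  "uq2_comultiplication q a b D tens \<Delta> \<longleftrightarrow>
     star_hom \<Delta> \<and>
     \<Delta> a = tens a a - cnj q *\<^sub>C tens b (D * star b) \<and>
     \<Delta> b = tens a b + tens b (D * star a) \<and>
     \<Delta> D = tens D D"

text \<open>The subalgebra \<open>{x. (\<phi> \<otimes> id) (\<Delta> x) = 1 \<otimes> x}\<close> and the map \<open>E\<^sub>\<phi> = ((h \<circ> \<phi>) \<otimes> id) \<circ> \<Delta>\<close>, where \<open>tens\<close> and
  \<open>tensT\<close> are the tensor products of \<open>'a\<close> with itself and of \<open>C(\<T>)\<close> with \<open>'a\<close>.\<close>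

definition quotient_subalgebra ::
    "('a::cstar_algebra \<Rightarrow> 'a \<Rightarrow> 't::cstar_algebra) \<Rightarrow> (C_circle \<Rightarrow> 'a \<Rightarrow> 'u::cstar_algebra) \<Rightarrow>
     ('a \<Rightarrow> 't) \<Rightarrow> ('a \<Rightarrow> C_circle) \<Rightarrow> 'a set" where
  "quotient_subalgebra tens tensT \<Delta> \<phi> = {x. tensor_map tens tensT \<phi> id (\<Delta> x) = tensT 1 x}"

definition quotient_expectation ::
    "('a::cstar_algebra \<Rightarrow> 'a \<Rightarrow> 't::cstar_algebra) \<Rightarrow> ('a \<Rightarrow> 't) \<Rightarrow> ('a \<Rightarrow> C_circle) \<Rightarrow> 'a \<Rightarrow> 'a" where
  "quotient_expectation tens \<Delta> \<phi> = tensor_map tens (*\<^sub>C) (haar_circle \<circ> \<phi>) id \<circ> \<Delta>"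

end

theory Submission
  imports Defs
begin

text \<open>Slicing \<open>(\<phi> \<otimes> id) \<circ> \<Delta>\<close> at the points of the circle gives an action \<open>\<alpha>\<close> by automorphisms that fix \<open>a\<close>
  and \<open>b\<close> and multiply \<open>D\<close> by \<open>z\<close>. The elements that are homogeneous for \<open>\<alpha>\<close> span a dense
  subalgebra, \<open>C(U\<^sub>q(2)/\<^sub>\<phi>\<T>)\<close> is the set of those of degree 0, and \<open>E\<^sub>\<phi>\<close> is the projection onto degree 0.
  Hence \<open>E\<^sub>\<phi> (v D\<^sup>n) \<rightarrow> 0\<close> for every \<open>v\<close>. A quasi-basis would give \<open>D\<^sup>n = \<Sum>\<^sub>j u\<^sub>j E\<^sub>\<phi> (v\<^sub>j D\<^sup>n) \<rightarrow> 0\<close>,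
  although \<open>D\<^sup>n\<close> is unitary.\<close>

text \<open>\<open>tensor_map\<close> is a definite description, so nothing can be said about
  \<open>\<phi> \<otimes> id\<close> or \<open>(h \<circ> \<phi>) \<otimes> id\<close> before they
  are known to exist as bounded maps; this obstacle shapes most of the proof. Slices by a
  contractive functional are bounded because they can be tested on matrix coefficients in the given
  representations. \<open>\<phi> \<otimes> id\<close> is not such a slice. Its bound comes from the
  fact that the norm of an element of \<open>C(\<T>) \<otimes> A\<close> is controlled by the norms
  of its fibres over the points of the circle, and each fibre of
  \<open>(\<phi> \<otimes> id) w\<close> is a slice of \<open>w\<close>. The same fact shows that
  equal fibres mean equal elements, which turns the equation defining the subalgebra into invariance
  under every \<open>\<alpha> z\<close>. Homogeneous elements are dense because the generators
  \<open>a\<close>, \<open>b\<close>, \<open>D\<close> have degrees 0, 0, 1. They also replace the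
  vector-valued integral of \<open>\<alpha> z x\<close> over the circle: on degree n the expectation
  is multiplication by the Haar integral of \<open>z\<^sup>n\<close>, which is 1 for n = 0 and 0
  otherwise.\<close>

section \<open>Elementary facts on C*-algebras\<close>

lemma scaleC_one [simp]: "1 *\<^sub>C x = (x :: 'a::cstar_algebra)"
  using scaleR_scaleC[of 1 x] by simp

lemma bounded_linear_scaleC: "bounded_linear (scaleC c :: 'a::cstar_algebra \<Rightarrow> 'a)"
  by (rule bounded_linear_intro[where K = "cmod c"])
     (auto simp: scaleC_add_right norm_scaleC scaleR_scaleC scaleC_scaleC mult.commute)

lemma scaleC_zero_left [simp]: "0 *\<^sub>C x = (0 :: 'a::cstar_algebra)"
  using scaleR_scaleC[of 0 x] by simp

lemma scaleC_zero_right [simp]: "c *\<^sub>C 0 = (0 :: 'a::cstar_algebra)"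
  using norm_scaleC[of c "0 :: 'a"] by simp

lemma star_one [simp]: "star 1 = (1 :: 'a::cstar_algebra)"
  using star_mult[of "star 1" "1 :: 'a"] by (simp add: star_star)

lemma bounded_linear_star: "bounded_linear (star :: 'a::cstar_algebra \<Rightarrow> 'a)"
  by (rule bounded_linear_intro[where K = 1])
     (simp_all add: star_add scaleR_scaleC star_scaleC norm_star_eq)

lemma star_homD:
  assumes "star_hom f"
  shows "f (x + y) = f x + f y" "f (c *\<^sub>C x) = c *\<^sub>C f x" "f (x * y) = f x * f y" "f 1 = 1"
    "f (star x) = star (f x)"
  using assms by (auto simp: star_hom_def)

lemma star_hom_comp: "star_hom f \<Longrightarrow> star_hom g \<Longrightarrow> star_hom (\<lambda>x. f (g x))"
  by (simp add: star_hom_def)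

lemma star_hom_linear: "star_hom f \<Longrightarrow> linear f"
  by (rule linearI) (simp_all add: star_homD scaleR_scaleC)

lemma star_hom_inj:
  assumes "star_hom f" "\<And>x. norm (f x) = norm x" "f x = f y"
  shows "x = y"
  using assms(2)[of "x - y"] assms(3) by (simp add: linear_diff[OF star_hom_linear[OF assms(1)]])

text \<open>Writing \<open>k = 1 - w\<close> turns \<open>k\<^sup>2 = 1 - y\<close> into the fixed point equation \<open>w = (y + w\<^sup>2) / 2\<close>, a
  contraction of the ball of radius \<open>\<parallel>y\<parallel> < 1\<close>.\<close>

lemma ex_selfadjoint_sqrt:
  fixes y :: "'a::cstar_algebra"
  assumes "star y = y" "norm y < 1"
  shows "\<exists>k. star k = k \<and> k * k = 1 - y"
proof -
  let ?r = "norm y" and ?f = "\<lambda>w. (1/2) *\<^sub>R (y + w * w)"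
  have "\<exists>!w\<in>cball 0 ?r. ?f w = w"
  proof (rule Banach_fix)
    show "?f ` cball 0 ?r \<subseteq> cball 0 ?r"
    proof (rule image_subsetI)
      fix w :: 'a assume "w \<in> cball 0 ?r"
      then have w: "norm w \<le> ?r" by simp
      have "norm (w * w) \<le> ?r * 1"
        by (rule order_trans[OF norm_mult_ineq]) (use w assms(2) in \<open>intro mult_mono; simp\<close>)
      then have "norm (y + w * w) \<le> 2 * ?r" using norm_triangle_ineq[of y "w * w"] by simp
      then show "?f w \<in> cball 0 ?r" by simp
    qed
    fix v w :: 'a assume "v \<in> cball 0 ?r" "w \<in> cball 0 ?r"
    then have vw: "norm v \<le> ?r" "norm w \<le> ?r" by simp_all
    have "norm (v * v - w * w) = norm (v * (v - w) + (v - w) * w)"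
      by (simp add: algebra_simps)
    also have "\<dots> \<le> norm v * norm (v - w) + norm (v - w) * norm w"
      by (meson add_mono norm_mult_ineq norm_triangle_le)
    also have "\<dots> \<le> ?r * norm (v - w) + norm (v - w) * ?r"
      using vw by (intro add_mono mult_mono) auto
    finally have *: "norm (v * v - w * w) \<le> 2 * (?r * norm (v - w))" by simp
    have "?f v - ?f w = (1/2) *\<^sub>R (v * v - w * w)" by (simp add: scaleR_diff_right[symmetric])
    then show "dist (?f v) (?f w) \<le> ?r * dist v w" using * by (simp add: dist_norm)
  qed (use assms(2) in \<open>auto simp: complete_eq_closed\<close>)
  then obtain w where "w \<in> cball 0 ?r" and fixed: "?f w = w"
    and "\<forall>v. v \<in> cball 0 ?r \<and> ?f v = v \<longrightarrow> v = w" by (elim ex1E conjE)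
  then have w: "norm w \<le> ?r" and uniq: "\<And>v. norm v \<le> ?r \<Longrightarrow> ?f v = v \<Longrightarrow> v = w"
    unfolding mem_cball_0 by blast+
  have "?f (star w) = star (?f w)"
    by (simp add: scaleR_scaleC star_scaleC star_add star_mult assms(1))
  then have star: "star w = w" by (intro uniq) (simp_all only: norm_star_eq w fixed)
  have "(1 - w) * (1 - w) = 1 - (2::real) *\<^sub>R w + w * w"
    by (simp add: algebra_simps scaleR_2)
  also have "2 *\<^sub>R w = y + w * w" by (subst (1) fixed[symmetric]) simp
  finally show ?thesis
    by (intro exI[of _ "1 - w"]) (simp add: star_diff_aux star)
qed

text \<open>If x has norm below 1, then 1 - x*x = k*k with k self-adjoint, and applying f gives
  |f(x)u|^2 + |f(k)u|^2 = |u|^2 for every vector u. This gives contractivity without spectral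
  theory.\<close>

lemma star_hom_bop_le:
  fixes f :: "'a::cstar_algebra \<Rightarrow> 'i bop"
  assumes f: "star_hom f"
  shows "norm (f x) \<le> norm x"
proof -
  have unit: "norm (f x) \<le> 1" if x: "norm x < 1" for x
  proof -
    have "norm (star x * x) < 1"
      using x by (simp add: norm_star_mult_self power_less_one_iff)
    then obtain k where k: "star k = k" "k * k = 1 - star x * x"
      using ex_selfadjoint_sqrt[of "star x * x"] by (auto simp: star_mult star_star)
    have "star (f x) * f x + star (f k) * f k = f (star x * x + k * k)"
      by (simp add: star_homD[OF f] k(1) flip: star_homD(5)[OF f])
    then have sum: "star (f x) * f x + star (f k) * f k = 1" by (simp add: k star_homD[OF f])
    show ?thesis
    proof (rule norm_bop_bound)
      fix u
      have sq: "Re (cinner (bop_apply (star T * T) u) u) = (norm (bop_apply T u))\<^sup>2" for T :: "'i bop"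
        by (simp add: bop_apply_simps cinner_star Re_cinner_self)
      have "(norm (bop_apply (f x) u))\<^sup>2 + (norm (bop_apply (f k) u))\<^sup>2 = (norm u)\<^sup>2"
        using arg_cong[OF sum, of "\<lambda>T. Re (cinner (bop_apply T u) u)"]
        by (simp add: bop_apply_simps(2,3) cinner_add_left sq Re_cinner_self)
      then have "(norm (bop_apply (f x) u))\<^sup>2 \<le> (norm u)\<^sup>2" by (smt (verit) zero_le_power2)
      then show "norm (bop_apply (f x) u) \<le> 1 * norm u" by (simp add: power2_le_iff_abs_le)
    qed simp
  qed
  \<comment> \<open>The square root exists only for norm strictly below 1, so x is rescaled to norm
    t, and t < 1 is arbitrary.\<close>
  show ?thesis
  proof (rule field_le_mult_one_interval)
    fix t :: real assume t: "0 < t" "t < 1"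
    show "t * norm (f x) \<le> norm x"
    proof (cases "x = 0")
      case True
      then show ?thesis using linear_0[OF star_hom_linear[OF f]] by simp
    next
      case False
      have "norm (f ((t / norm x) *\<^sub>R x)) \<le> 1" using False t by (intro unit) simp
      then show ?thesis
        using False t by (simp add: linear_scale[OF star_hom_linear[OF f]] field_simps)
    qed
  qed
qed

text \<open>An isometric representation of the codomain reduces the claim to operators. In the
  applications it is one of the representations that come with a spatial tensor product.\<close>

lemma star_hom_le:
  fixes f :: "'a::cstar_algebra \<Rightarrow> 'b::cstar_algebra" and \<pi> :: "'b \<Rightarrow> 'i bop"
  assumes "star_hom f" "star_hom \<pi>" "\<And>y. norm (\<pi> y) = norm y"
  shows "norm (f x) \<le> norm x"
  using star_hom_bop_le[OF star_hom_comp[OF assms(2,1)], of x] assms(3) by simp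

section \<open>Bounded linear maps on dense subspaces\<close>

lemma subspace_closure:
  fixes S :: "'a::real_normed_vector set"
  assumes "subspace S"
  shows "subspace (closure S)"
proof (rule subspaceI)
  show "0 \<in> closure S" using assms closure_subset subspace_0 by blast
next
  fix x y assume "x \<in> closure S" "y \<in> closure S"
  then obtain f g where "\<And>n. f n \<in> S" "f \<longlonglongrightarrow> x" "\<And>n. g n \<in> S" "g \<longlonglongrightarrow> y"
    unfolding closure_sequential by blast
  then show "x + y \<in> closure S"
    unfolding closure_sequential using assms
    by (intro exI[of _ "\<lambda>n. f n + g n"]) (auto intro: tendsto_add subspace_add)
next
  fix c x assume "x \<in> closure S"
  then obtain f where "\<And>n. f n \<in> S" "f \<longlonglongrightarrow> x"
    unfolding closure_sequential by blast
  then show "c *\<^sub>R x \<in> closure S"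
    unfolding closure_sequential using assms
    by (intro exI[of _ "\<lambda>n. c *\<^sub>R f n"]) (auto intro: tendsto_scaleR subspace_scale)
qed

lemma dense_span_induct:
  assumes "closure (span S) = UNIV" "subspace V" "closed V" "S \<subseteq> V"
  shows "x \<in> V"
  using closure_minimal[OF span_minimal[OF assms(4,2)] assms(3)] assms(1) by auto

lemma subspace_eq:
  assumes "bounded_linear F" "bounded_linear G"
  shows "subspace {x. F x = G x}" "closed {x. F x = G x}"
proof -
  interpret F: bounded_linear F by fact
  interpret G: bounded_linear G by fact
  show "subspace {x. F x = G x}"
    by (rule subspaceI) (simp_all add: F.add G.add F.scale G.scale F.zero G.zero)
  show "closed {x. F x = G x}"
    by (intro closed_Collect_eq linear_continuous_on assms)
qed

lemma bounded_linear_eqI: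
  assumes "closure (span S) = UNIV" "bounded_linear F" "bounded_linear G"
    and "\<And>x. x \<in> S \<Longrightarrow> F x = G x"
  shows "F x = G x"
  using dense_span_induct[OF assms(1) subspace_eq[OF assms(2,3)], of x] assms(4) by auto

lemma image_closure_span_subset:
  assumes "bounded_linear f" "f ` S \<subseteq> closure (span T)"
  shows "f ` closure (span S) \<subseteq> closure (span T)"
proof -
  have "f ` span S \<subseteq> closure (span T)"
    using assms linear_span_image[OF bounded_linear.linear[OF assms(1)], of S]
      span_minimal[OF assms(2) subspace_closure[OF subspace_span]] by simp
  then show ?thesis
    using closure_bounded_linear_image_subset[OF assms(1), of "span S"] closure_minimal
      closed_closure by blast
qed

lemma cstar_subalgebra_closure_span:
  fixes S :: "'a::cstar_algebra set"
  assumes "1 \<in> S" "\<And>x y. x \<in> S \<Longrightarrow> y \<in> S \<Longrightarrow> x * y \<in> S" "\<And>c x. x \<in> S \<Longrightarrow> c *\<^sub>C x \<in> S"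
    and "\<And>x. x \<in> S \<Longrightarrow> star x \<in> S"
  shows "cstar_subalgebra (closure (span S))"
proof -
  let ?C = "closure (span S)"
  have S: "S \<subseteq> ?C" by (meson closure_subset dual_order.trans span_superset)
  have stable: "f x \<in> ?C" if "bounded_linear f" "\<And>y. y \<in> S \<Longrightarrow> f y \<in> ?C" "x \<in> ?C" for f x
    using image_closure_span_subset[OF that(1), of S S] that(2,3) by auto
  \<comment> \<open>The closure is reached in one factor at a time, since multiplication by a fixed
    element is bounded and linear.\<close>
  have "x * y \<in> ?C" if x: "x \<in> ?C" and y: "y \<in> ?C" for x y
  proof (rule stable[OF bounded_linear_mult_right _ y])
    fix s assume s: "s \<in> S"
    show "x * s \<in> ?C"
      by (rule stable[OF bounded_linear_mult_left _ x]) (use s assms(2) S in blast)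
  qed
  moreover have "c *\<^sub>C x \<in> ?C" if "x \<in> ?C" for c x
    by (rule stable[OF bounded_linear_scaleC _ that]) (use assms(3) S in blast)
  moreover have "star x \<in> ?C" if "x \<in> ?C" for x
    by (rule stable[OF bounded_linear_star _ that]) (use assms(4) S in blast)
  moreover have "x + y \<in> ?C" if "x \<in> ?C" "y \<in> ?C" for x y
    using that by (intro subspace_add subspace_closure subspace_span)
  ultimately show ?thesis using assms(1) S by (auto simp: cstar_subalgebra_def)
qed

text \<open>A linear relation \<open>R\<close> with dense domain and \<open>\<parallel>y\<parallel> \<le> K \<parallel>x\<parallel>\<close> for \<open>(x, y) \<in> R\<close> is the graph of a
  partial bounded map; its closure is the graph of the extension.\<close>

lemma ex_bounded_linear_extension:
  fixes R :: "('a::real_normed_vector \<times> 'b::{real_normed_vector, complete_space}) set"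
  assumes sub: "subspace R" and dense: "closure (fst ` R) = UNIV"
    and bound: "\<And>x y. (x, y) \<in> R \<Longrightarrow> norm y \<le> K * norm x"
  shows "\<exists>F. bounded_linear F \<and> (\<forall>x. norm (F x) \<le> K * norm x) \<and> (\<forall>(x, y)\<in>R. F x = y)"
proof -
  let ?R = "closure R"
  have subR: "subspace ?R" by (rule subspace_closure[OF sub])
  have "?R \<subseteq> {p. norm (snd p) \<le> K * norm (fst p)}"
    by (rule closure_minimal) (use bound in \<open>auto intro!: closed_Collect_le continuous_intros\<close>)
  then have boundR: "norm y \<le> K * norm x" if "(x, y) \<in> ?R" for x y using that by auto
  have single: "y = y'" if "(x, y) \<in> ?R" "(x, y') \<in> ?R" for x y y'
    using boundR[of 0 "y - y'"] subspace_diff[OF subR that] by simp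
  have "\<exists>y. (x, y) \<in> ?R" for x
  proof -
    have "x \<in> closure (fst ` R)" using dense by simp
    then obtain f where f: "\<And>n. f n \<in> fst ` R" "f \<longlonglongrightarrow> x" unfolding closure_sequential by blast
    then have "\<forall>n. \<exists>y. (f n, y) \<in> R" by force
    then obtain g where g: "\<And>n. (f n, g n) \<in> R" by metis
    have gle: "norm (g m - g n) \<le> K * norm (f m - f n)" for m n
      using bound[of "f m - f n" "g m - g n"] subspace_diff[OF sub g[of m] g[of n]] by simp
    have "Cauchy g"
    proof (rule metric_CauchyI)
      fix e :: real assume e: "e > 0"
      obtain M where M: "\<And>m n. m \<ge> M \<Longrightarrow> n \<ge> M \<Longrightarrow> dist (f m) (f n) < e / (\<bar>K\<bar> + 1)"
        using metric_CauchyD[OF LIMSEQ_imp_Cauchy[OF f(2)], of "e / (\<bar>K\<bar> + 1)"] e by auto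
      have "dist (g m) (g n) < e" if mn: "m \<ge> M" "n \<ge> M" for m n
      proof -
        have "dist (g m) (g n) \<le> (\<bar>K\<bar> + 1) * norm (f m - f n)"
          unfolding dist_norm by (rule order_trans[OF gle]) (auto intro: mult_right_mono)
        also have "\<dots> < e" using M[OF mn] by (simp add: dist_norm field_simps)
        finally show ?thesis .
      qed
      then show "\<exists>M. \<forall>m\<ge>M. \<forall>n\<ge>M. dist (g m) (g n) < e" by blast
    qed
    then obtain y where "g \<longlonglongrightarrow> y" by (auto simp: Cauchy_convergent_iff convergent_def)
    then have "(\<lambda>n. (f n, g n)) \<longlonglongrightarrow> (x, y)" by (intro tendsto_Pair f(2))
    moreover have "\<forall>n. (f n, g n) \<in> R" using g by blast
    ultimately show ?thesis unfolding closure_sequential by (intro exI) (rule conjI)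
  qed
  then obtain F where F: "\<And>x. (x, F x) \<in> ?R" by metis
  have "F (x + y) = F x + F y" for x y
    by (rule single[OF F]) (use subspace_add[OF subR F[of x] F[of y]] in simp)
  moreover have "F (c *\<^sub>R x) = c *\<^sub>R F x" for c x
    by (rule single[OF F]) (use subspace_scale[OF subR F[of x], of c] in simp)
  ultimately have "bounded_linear F"
    using boundR[OF F] by (intro bounded_linear_intro[where K = K]) (auto simp: mult.commute)
  moreover have "F x = y" if "(x, y) \<in> R" for x y
    using single[OF F] closure_subset that by blast
  ultimately show ?thesis using boundR[OF F] by (intro exI[of _ F]) auto
qed

section \<open>Tensor products\<close>

lemma cinner_tensor:
  "cinner (ell2_tensor u v) (ell2_tensor u' v') = cinner u u' * cinner v v'"
proof -
  let ?f = "\<lambda>i. cnj (ell2_apply u i) * ell2_apply u' i"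
  let ?g = "\<lambda>j. cnj (ell2_apply v j) * ell2_apply v' j"
  have "(\<lambda>p. norm (case p of (i, j) \<Rightarrow> ?f i * ?g j)) summable_on (UNIV \<times> UNIV)"
    by (rule Infinite_Sum.abs_summable_on_Sigma_iff[THEN iffD2])
       (use cinner_abs_summable[of u u'] cinner_abs_summable[of v v'] in
         \<open>auto simp: norm_mult[of "cnj _ * _"] infsum_cmult_right' infsum_nonneg
           intro: summable_on_cmult_right summable_on_cmult_left\<close>)
  then have "(\<lambda>(i, j). ?f i * ?g j) summable_on (UNIV \<times> UNIV)"
    by (rule abs_summable_summable)
  from infsum_Sigma'_banach[OF this]
  have "(\<Sum>\<^sub>\<infinity>i. \<Sum>\<^sub>\<infinity>j. ?f i * ?g j) = (\<Sum>\<^sub>\<infinity>(i, j). ?f i * ?g j)" by simp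
  also have "\<dots> = cinner (ell2_tensor u v) (ell2_tensor u' v')"
    unfolding cinner_def by (rule infsum_cong) (auto simp: ell2_tensor.rep_eq)
  finally show ?thesis by (simp add: cinner_def infsum_cmult_left' infsum_cmult_right')
qed

lemma norm_ell2_tensor: "norm (ell2_tensor u v) = norm u * norm v"
proof -
  have "complex_of_real ((norm (ell2_tensor u v))\<^sup>2) = complex_of_real ((norm u * norm v)\<^sup>2)"
    using cinner_tensor[of u v u v]
    by (simp only: cinner_self norm_ell2_sq[symmetric] power_mult_distrib of_real_mult)
  then show ?thesis by (simp only: of_real_eq_iff power2_eq_iff_nonneg norm_ge_zero mult_nonneg_nonneg)
qed

lemma ell2_tensor_basis: "ell2_tensor (ell2_basis i) (ell2_basis j) = ell2_basis (i, j)"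
  by (rule ell2_eqI) (auto simp: ell2_tensor.rep_eq ell2_basis.rep_eq split: if_splits)

lemma bop_eq_basisI:
  fixes S T :: "'i bop"
  assumes "\<And>i. bop_apply S (ell2_basis i) = bop_apply T (ell2_basis i)"
  shows "S = T"
proof (rule bop_eqI)
  fix x
  have "((\<lambda>i. bop_apply R (ell2_apply x i *\<^sub>C ell2_basis i)) has_sum bop_apply R x) UNIV" for R :: "'i bop"
    using has_sum_bounded_linear[OF blinfun.bounded_linear_right[of "bop_blinfun R"]
        ell2_basis_has_sum[of x]] by (simp add: o_def)
  from this[of S] this[of T] show "bop_apply S x = bop_apply T x"
    by (simp add: bop_apply_scaleC assms has_sum_unique)
qed

text \<open>The basis vectors of the product space are elementary tensors. This is what makes a
  formula such as \<open>\<sigma>_tens\<close>, given on elementary tensors only, determine an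
  operator.\<close>

lemma bop_eq_tensorI:
  assumes "\<And>u v. bop_apply S (ell2_tensor u v) = bop_apply T (ell2_tensor u v)"
  shows "S = T"
  by (rule bop_eq_basisI) (metis assms ell2_tensor_basis surj_pair)

lemma ell2_eq_tensorI:
  fixes x y :: "('i \<times> 'j) ell2"
  assumes "\<And>u v. cinner (ell2_tensor u v) x = cinner (ell2_tensor u v) y"
  shows "x = y"
proof (rule ell2_eqI)
  fix p
  have coord: "cinner (ell2_basis p) x = ell2_apply x p" for x :: "('i \<times> 'j) ell2"
  proof -
    have "cinner (ell2_basis p) x = (\<Sum>\<^sub>\<infinity>i\<in>{p}. ell2_apply x i)"
      unfolding cinner_def by (rule infsum_cong_neutral) (auto simp: ell2_basis.rep_eq)
    then show ?thesis by simp
  qed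
  show "ell2_apply x p = ell2_apply y p"
    using assms[of "ell2_basis (fst p)" "ell2_basis (snd p)"] by (simp add: ell2_tensor_basis coord)
qed

lemma ell2_tensor_add:
  "ell2_tensor (u + u') v = ell2_tensor u v + ell2_tensor u' v"
  "ell2_tensor u (v + v') = ell2_tensor u v + ell2_tensor u v'"
  "ell2_tensor (c *\<^sub>C u) v = c *\<^sub>C ell2_tensor u v"
  "ell2_tensor u (c *\<^sub>C v) = c *\<^sub>C ell2_tensor u v"
  by (rule ell2_eqI; auto simp: ell2_tensor.rep_eq plus_ell2.rep_eq scaleC_ell2.rep_eq algebra_simps)+

section \<open>Norm estimates through matrix coefficients\<close>

lemma norm_bop_le_cinner:
  fixes T :: "'i bop"
  assumes "0 \<le> K" "\<And>u v. cmod (cinner v (bop_apply T u)) \<le> K * norm u * norm v"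
  shows "norm T \<le> K"
proof (rule norm_bop_bound[OF assms(1)])
  fix u
  let ?v = "bop_apply T u"
  have "(norm ?v)\<^sup>2 \<le> K * norm u * norm ?v"
    using assms(2)[of ?v u] complex_Re_le_cmod[of "cinner ?v ?v"] by (simp add: Re_cinner_self)
  then show "norm ?v \<le> K * norm u"
    using assms(1) by (cases "norm ?v = 0") (auto simp: power2_eq_square)
qed

text \<open>The sum is \<open>V* diag(y) V\<close> for the column
  \<open>V u = (h\<^sub>k u)\<^sub>k\<close>, which is an isometry because the squares of the
  self-adjoint \<open>h\<^sub>k\<close> sum to 1. The proof spells this out with the Cauchy-Schwarz
  inequality, in the Hilbert space and then over k.\<close>

lemma norm_sum_conj_le:
  fixes h y :: "'k \<Rightarrow> 'i bop"
  assumes K: "finite K" and h: "\<And>k. k \<in> K \<Longrightarrow> star (h k) = h k" "(\<Sum>k\<in>K. h k * h k) = 1"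
    and y: "\<And>k. k \<in> K \<Longrightarrow> norm (y k) \<le> M" and M: "0 \<le> M"
  shows "norm (\<Sum>k\<in>K. h k * y k * h k) \<le> M"
proof (rule norm_bop_le_cinner[OF M])
  have ap: "bop_apply (\<Sum>k\<in>K. f k) u = (\<Sum>k\<in>K. bop_apply (f k) u)" for f :: "'k \<Rightarrow> 'i bop" and u
    by (induction K rule: infinite_finite_induct) (auto simp: bop_apply_simps)
  have ci: "cinner v (\<Sum>k\<in>K. f k) = (\<Sum>k\<in>K. cinner v (f k))" for f :: "'k \<Rightarrow> 'i ell2" and v
    by (induction K rule: infinite_finite_induct) (auto simp: cinner_add_right)
  \<comment> \<open>This is the isometry of the column V.\<close>
  have sq: "L2_set (\<lambda>k. norm (bop_apply (h k) u)) K = norm u" for u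
  proof -
    have "(\<Sum>k\<in>K. (norm (bop_apply (h k) u))\<^sup>2) = (\<Sum>k\<in>K. Re (cinner u (bop_apply (h k * h k) u)))"
      using h(1) by (intro sum.cong refl) (metis Re_cinner_self bop_apply_simps(6) cinner_star)
    also have "\<dots> = Re (cinner u (bop_apply (\<Sum>k\<in>K. h k * h k) u))" by (simp add: ap ci)
    also have "\<dots> = (norm u)\<^sup>2" by (simp add: h(2) bop_apply_simps Re_cinner_self)
    finally show ?thesis by (simp add: L2_set_def)
  qed
  fix u v
  have "cmod (cinner v (bop_apply (\<Sum>k\<in>K. h k * y k * h k) u)) =
      cmod (\<Sum>k\<in>K. cinner (bop_apply (h k) v) (bop_apply (y k) (bop_apply (h k) u)))"
    using h(1) by (simp add: ap ci bop_apply_simps) (metis (no_types, lifting) cinner_star sum.cong)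
  also have "\<dots> \<le> (\<Sum>k\<in>K. norm (bop_apply (h k) v) * (M * norm (bop_apply (h k) u)))"
  proof (rule sum_norm_le)
    fix k assume k: "k \<in> K"
    have "norm (bop_apply (y k) (bop_apply (h k) u)) \<le> M * norm (bop_apply (h k) u)"
      using norm_bop_apply[of "y k"] y[OF k] by (meson mult_right_mono norm_ge_zero order_trans)
    then show "cmod (cinner (bop_apply (h k) v) (bop_apply (y k) (bop_apply (h k) u)))
        \<le> norm (bop_apply (h k) v) * (M * norm (bop_apply (h k) u))"
      using cinner_cauchy_schwarz by (meson mult_left_mono norm_ge_zero order_trans)
  qed
  also have "\<dots> = M * (\<Sum>k\<in>K. \<bar>norm (bop_apply (h k) v)\<bar> * \<bar>norm (bop_apply (h k) u)\<bar>)"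
    by (simp add: sum_distrib_left mult_ac)
  also have "\<dots> \<le> M * (norm v * norm u)"
    using L2_set_mult_ineq[of "\<lambda>k. norm (bop_apply (h k) v)" "\<lambda>k. norm (bop_apply (h k) u)" K]
    by (intro mult_left_mono M) (simp add: sq)
  finally show "cmod (cinner v (bop_apply (\<Sum>k\<in>K. h k * y k * h k) u)) \<le> M * norm u * norm v"
    by (simp add: mult_ac)
qed

section \<open>Algebra and bounded maps on a spatial tensor product\<close>

locale spatial_tensor =
  fixes tens :: "'a::cstar_algebra \<Rightarrow> 'b::cstar_algebra \<Rightarrow> 't::cstar_algebra"
    and \<pi> :: "'a \<Rightarrow> 'a bop" and \<rho> :: "'b \<Rightarrow> 'b bop" and \<sigma> :: "'t \<Rightarrow> ('a \<times> 'b) bop"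
  assumes dense: "closure (span {tens x y |x y. True}) = UNIV"
    and hom: "star_hom \<pi>" "star_hom \<rho>" "star_hom \<sigma>"
    and isometric: "\<And>x. norm (\<pi> x) = norm x" "\<And>y. norm (\<rho> y) = norm y" "\<And>z. norm (\<sigma> z) = norm z"
    and \<sigma>_tens: "\<And>x y u v. bop_apply (\<sigma> (tens x y)) (ell2_tensor u v) =
           ell2_tensor (bop_apply (\<pi> x) u) (bop_apply (\<rho> y) v)"
begin

lemma \<sigma>_inj: "\<sigma> z = \<sigma> z' \<Longrightarrow> z = z'"
  by (rule star_hom_inj[OF hom(3) isometric(3)])

text \<open>Bilinearity and multiplicativity of \<open>tens\<close> are not among the axioms. They
  hold because \<open>\<sigma>\<close> is injective and both sides act alike on elementary
  tensors.\<close>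

lemma tens_simps:
  "tens (x + x') y = tens x y + tens x' y" "tens x (y + y') = tens x y + tens x y'"
  "tens (c *\<^sub>C x) y = c *\<^sub>C tens x y" "tens x (c *\<^sub>C y) = c *\<^sub>C tens x y"
  "tens x y * tens x' y' = tens (x * x') (y * y')" "tens 1 1 = 1"
  by (rule \<sigma>_inj, rule bop_eq_tensorI;
      simp add: \<sigma>_tens star_homD[OF hom(1)] star_homD[OF hom(2)] star_homD[OF hom(3)]
        bop_apply_simps ell2_tensor_add)+

text \<open>The adjoint is accessible only through inner products, so both sides are also paired
  with elementary tensors.\<close>

lemma star_tens: "star (tens x y) = tens (star x) (star y)"
proof (rule \<sigma>_inj, rule bop_eq_tensorI)
  fix u v
  show "bop_apply (\<sigma> (star (tens x y))) (ell2_tensor u v) =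
      bop_apply (\<sigma> (tens (star x) (star y))) (ell2_tensor u v)"
  proof (rule ell2_eq_tensorI)
    fix u' v'
    have adj: "cinner w (bop_apply (star T) w') = cinner (bop_apply T w) w'" for T :: "'k bop" and w w'
      by (metis cinner_star star_star_bop)
    show "cinner (ell2_tensor u' v') (bop_apply (\<sigma> (star (tens x y))) (ell2_tensor u v)) =
        cinner (ell2_tensor u' v') (bop_apply (\<sigma> (tens (star x) (star y))) (ell2_tensor u v))"
      by (simp add: \<sigma>_tens star_homD(5)[OF hom(1)] star_homD(5)[OF hom(2)] star_homD(5)[OF hom(3)]
          adj cinner_tensor)
  qed
qed

lemma eq_on_tensI:
  assumes "bounded_linear F" "bounded_linear G" "\<And>x y. F (tens x y) = G (tens x y)"
  shows "F z = G z"
  by (rule bounded_linear_eqI[OF dense assms(1,2)]) (use assms(3) in auto)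

text \<open>Density of the elementary tensors gives the uniqueness required by the definite
  description, so exhibiting one bounded map is enough to compute \<open>tensor_map\<close>.\<close>

lemma tensor_map_eqI:
  assumes "bounded_linear F" "\<And>x y. F (tens x y) = tens' (f x) (g y)"
  shows "tensor_map tens tens' f g = F"
  unfolding tensor_map_def
proof (rule the_equality)
  fix G assume G: "bounded_linear G \<and> (\<forall>x y. G (tens x y) = tens' (f x) (g y))"
  show "G = F" by (rule ext, rule eq_on_tensI) (use G assms in auto)
qed (use assms in auto)

text \<open>Each identity is extended by density, multiplicativity in one factor after the other.
  Complex homogeneity is checked as well, because \<open>bounded_linear\<close> is a notion over the
  reals.\<close>

lemma star_hom_on_tensI:
  fixes F :: "'t \<Rightarrow> 'c::cstar_algebra"
  assumes F: "bounded_linear F"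
    and one: "F (tens 1 1) = 1" and scale: "\<And>c x y. F (c *\<^sub>C tens x y) = c *\<^sub>C F (tens x y)"
    and mult: "\<And>x y x' y'. F (tens x y * tens x' y') = F (tens x y) * F (tens x' y')"
    and star: "\<And>x y. F (star (tens x y)) = star (F (tens x y))"
  shows "star_hom F"
proof -
  have m1: "F (z * tens x y) = F z * F (tens x y)" for z x y
    by (rule eq_on_tensI[where F = "\<lambda>z. F (z * tens x y)"])
       (intro bounded_linear_compose[OF F] bounded_linear_mult_left
          bounded_linear_compose[OF bounded_linear_mult_left F] mult)+
  have "F (z * w) = F z * F w" for z w
    by (rule eq_on_tensI[where F = "\<lambda>w. F (z * w)"])
       (intro bounded_linear_compose[OF F] bounded_linear_mult_right
          bounded_linear_compose[OF bounded_linear_mult_right F] m1)+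
  moreover have "F (c *\<^sub>C z) = c *\<^sub>C F z" for c z
    by (rule eq_on_tensI[where F = "\<lambda>z. F (c *\<^sub>C z)"])
       (intro bounded_linear_compose[OF F] bounded_linear_scaleC
          bounded_linear_compose[OF bounded_linear_scaleC F] scale)+
  moreover have "F (star z) = star (F z)" for z
    by (rule eq_on_tensI[where F = "\<lambda>z. F (star z)"])
       (intro bounded_linear_compose[OF F] bounded_linear_star
          bounded_linear_compose[OF bounded_linear_star F] star)+
  ultimately show ?thesis
    using one linear_add[OF bounded_linear.linear[OF F]] by (simp add: star_hom_def tens_simps(6))
qed

text \<open>An element of the span can be a sum of elementary tensors in many ways. The norm bound
  on the span of the pairs gives well-definedness and continuity at once.\<close>

lemma ex_bounded_on_tens:
  fixes g :: "'a \<Rightarrow> 'b \<Rightarrow> 'c::cstar_algebra"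
  assumes "\<And>z w. (z, w) \<in> span {(tens x y, g x y) |x y. True} \<Longrightarrow> norm w \<le> norm z"
  shows "\<exists>F. bounded_linear F \<and> (\<forall>z. norm (F z) \<le> norm z) \<and> (\<forall>x y. F (tens x y) = g x y)"
proof -
  let ?G = "{(tens x y, g x y) |x y. True}"
  have "fst ` span ?G = span (fst ` ?G)"
    using linear_span_image[OF linear_fst, of ?G] by simp
  also have "fst ` ?G = {tens x y |x y. True}" by force
  finally have "\<exists>F. bounded_linear F \<and> (\<forall>z. norm (F z) \<le> 1 * norm z) \<and> (\<forall>(z, w)\<in>span ?G. F z = w)"
    using assms dense by (intro ex_bounded_linear_extension subspace_span) auto
  then obtain F where F: "bounded_linear F" "\<forall>z. norm (F z) \<le> norm z" "\<forall>(z, w)\<in>span ?G. F z = w"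
    by auto
  have "F (tens x y) = g x y" for x y
    using bspec[OF F(3) span_base, of "(tens x y, g x y)"] by auto
  with F(1,2) show ?thesis by blast
qed

text \<open>Slicing the second leg of \<open>z\<close> by the vector functional \<open>y \<mapsto> \<langle>v', \<rho>(y) v\<rangle>\<close> gives \<open>s\<close> with
  \<open>\<parallel>s\<parallel> \<le> \<parallel>z\<parallel> \<parallel>v\<parallel> \<parallel>v'\<parallel>\<close>, and \<open>\<omega>(s)\<close> is the matrix coefficient at \<open>v\<close>, \<open>v'\<close> of the slice of \<open>z\<close> by \<open>\<omega>\<close>.\<close>

lemma ex_slice:
  fixes \<omega> :: "'a \<Rightarrow> complex"
  assumes add: "\<And>x y. \<omega> (x + y) = \<omega> x + \<omega> y" and scale: "\<And>c x. \<omega> (c *\<^sub>C x) = c * \<omega> x"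
    and bound: "\<And>x. cmod (\<omega> x) \<le> norm x"
  shows "\<exists>F. bounded_linear F \<and> (\<forall>z. norm (F z) \<le> norm z) \<and> (\<forall>x y. F (tens x y) = \<omega> x *\<^sub>C y)"
proof -
  define G where "G = {(tens x y, \<omega> x *\<^sub>C y) |x y. True}"
  let ?P = "\<lambda>z w v v'. \<exists>s. \<omega> s = cinner v' (bop_apply (\<rho> w) v) \<and>
     (\<forall>u u'. cinner u' (bop_apply (\<pi> s) u) =
        cinner (ell2_tensor u' v') (bop_apply (\<sigma> z) (ell2_tensor u v)))"
  have "?P z w v v'" if "(z, w) \<in> span G" for z w v v'
  proof -
    have "(z, w) \<in> {p. ?P (fst p) (snd p) v v'}"
    proof (rule subsetD[OF span_minimal that])
      show "G \<subseteq> {p. ?P (fst p) (snd p) v v'}"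
      proof
        fix p assume "p \<in> G"
        then obtain x y where p: "p = (tens x y, \<omega> x *\<^sub>C y)" by (auto simp: G_def)
        show "p \<in> {p. ?P (fst p) (snd p) v v'}"
          by (auto simp: p scale \<sigma>_tens cinner_tensor star_homD[OF hom(1)] star_homD[OF hom(2)]
              bop_apply_simps cinner_scaleC_right
              intro!: exI[of _ "cinner v' (bop_apply (\<rho> y) v) *\<^sub>C x"])
      qed
      have \<omega>0: "\<omega> 0 = 0" using scale[of 0 0] by simp
      show "subspace {p. ?P (fst p) (snd p) v v'}"
      proof (rule subspaceI)
        show "0 \<in> {p. ?P (fst p) (snd p) v v'}"
          using hom[THEN star_hom_linear, THEN linear_0] \<omega>0
          by (auto simp: bop_apply_simps intro!: exI[of _ 0])
      next
        fix p p' assume "p \<in> {p. ?P (fst p) (snd p) v v'}" "p' \<in> {p. ?P (fst p) (snd p) v v'}"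
        then obtain s s' where "\<omega> s = cinner v' (bop_apply (\<rho> (snd p)) v)"
            "\<omega> s' = cinner v' (bop_apply (\<rho> (snd p')) v)"
            "\<And>u u'. cinner u' (bop_apply (\<pi> s) u) =
              cinner (ell2_tensor u' v') (bop_apply (\<sigma> (fst p)) (ell2_tensor u v))"
            "\<And>u u'. cinner u' (bop_apply (\<pi> s') u) =
              cinner (ell2_tensor u' v') (bop_apply (\<sigma> (fst p')) (ell2_tensor u v))" by blast
        then show "p + p' \<in> {p. ?P (fst p) (snd p) v v'}"
          by (auto simp: add star_homD(1)[OF hom(1)] star_homD(1)[OF hom(2)] star_homD(1)[OF hom(3)]
              bop_apply_simps cinner_add_right intro!: exI[of _ "s + s'"])
      next
        fix r and p assume "p \<in> {p. ?P (fst p) (snd p) v v'}"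
        then obtain s where "\<omega> s = cinner v' (bop_apply (\<rho> (snd p)) v)"
            "\<And>u u'. cinner u' (bop_apply (\<pi> s) u) =
              cinner (ell2_tensor u' v') (bop_apply (\<sigma> (fst p)) (ell2_tensor u v))" by blast
        then show "r *\<^sub>R p \<in> {p. ?P (fst p) (snd p) v v'}"
          by (auto simp: scaleR_scaleC scale star_homD(2)[OF hom(1)] star_homD(2)[OF hom(2)]
              star_homD(2)[OF hom(3)] bop_apply_simps cinner_scaleC_right
              intro!: exI[of _ "complex_of_real r *\<^sub>C s"])
      qed
    qed
    then show ?thesis by simp
  qed
  note slice = this
  have "norm w \<le> norm z" if zw: "(z, w) \<in> span G" for z w
  proof -
    have "norm (\<rho> w) \<le> norm z"
    proof (rule norm_bop_le_cinner)
      fix v v'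
      obtain s where s: "\<omega> s = cinner v' (bop_apply (\<rho> w) v)"
        "\<And>u u'. cinner u' (bop_apply (\<pi> s) u) =
          cinner (ell2_tensor u' v') (bop_apply (\<sigma> z) (ell2_tensor u v))"
        using slice[OF zw, of v' v] by blast
      have "norm (\<pi> s) \<le> norm z * norm v * norm v'"
      proof (rule norm_bop_le_cinner)
        fix u u'
        have "cmod (cinner u' (bop_apply (\<pi> s) u)) \<le>
            norm (ell2_tensor u' v') * norm (bop_apply (\<sigma> z) (ell2_tensor u v))"
          unfolding s by (rule cinner_cauchy_schwarz)
        also have "\<dots> \<le> norm (ell2_tensor u' v') * (norm z * norm (ell2_tensor u v))"
          using norm_bop_apply[of "\<sigma> z" "ell2_tensor u v"] isometric(3)[of z]
          by (intro mult_left_mono) auto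
        finally show "cmod (cinner u' (bop_apply (\<pi> s) u)) \<le>
            norm z * norm v * norm v' * norm u * norm u'"
          by (simp add: norm_ell2_tensor mult_ac)
      qed simp
      then show "cmod (cinner v' (bop_apply (\<rho> w) v)) \<le> norm z * norm v * norm v'"
        using bound[of s] isometric(1)[of s] s(1) by simp
    qed simp
    then show ?thesis using isometric(2)[of w] by simp
  qed
  then show ?thesis using ex_bounded_on_tens[of "\<lambda>x y. \<omega> x *\<^sub>C y"] by (simp add: G_def)
qed

lemma star_hom_tens: "star_hom (\<lambda>x. tens x 1)" "star_hom (\<lambda>y. tens 1 y)"
  by (simp_all add: star_hom_def tens_simps star_tens)

lemma linear_tens: "linear (\<lambda>x. tens x y)"
  by (rule linearI) (simp_all add: tens_simps scaleR_scaleC)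

text \<open>The tensor factors as \<open>tens x 1 * tens 1 y\<close>, and both embeddings of the
  legs are contractive *-homomorphisms.\<close>

lemma norm_tens_le: "norm (tens x y) \<le> norm x * norm y"
proof -
  have "norm (tens x 1 * tens 1 y) \<le> norm (tens x 1) * norm (tens 1 y)" by (rule norm_mult_ineq)
  also have "\<dots> \<le> norm x * norm y"
    using star_hom_tens[THEN star_hom_le, OF hom(3) isometric(3)] by (intro mult_mono) auto
  finally show ?thesis by (simp add: tens_simps)
qed

end

section \<open>The circle\<close>

lemma of_circle_norm [simp]: "norm (of_circle z) = 1"
  using of_circle[of z] by simp

lemma of_circle_nonzero [simp]: "of_circle z \<noteq> 0"
  using of_circle_norm[of z] by (metis norm_zero zero_neq_one)

lemma continuous_on_of_circle: "continuous_on S of_circle"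
  by (rule continuous_onI) (auto simp: dist_circle_def)

lemma continuous_on_Circle: "continuous_on (sphere 0 1) Circle"
  by (rule continuous_onI) (auto simp: dist_circle_def Circle_inverse)

lemma compact_circle: "compact (UNIV :: circle set)"
proof -
  have "UNIV = Circle ` sphere 0 1" by (metis of_circle of_circle_inverse UNIV_eq_I imageI)
  then show ?thesis by (metis compact_continuous_image compact_sphere continuous_on_Circle)
qed

lemma apply_bcontfun_Bcontfun:
  "continuous_on UNIV f \<Longrightarrow> apply_bcontfun (Bcontfun f :: C_circle) z = f z"
  using compact_imp_bounded[OF compact_continuous_image[OF _ compact_circle], of f]
  by (subst Bcontfun_inverse) (auto simp: bcontfun_def)

lemma C_circle_apply:
  "apply_bcontfun (1 :: C_circle) z = 1"
  "apply_bcontfun (f * g :: C_circle) z = apply_bcontfun f z * apply_bcontfun g z"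
  "apply_bcontfun (star f :: C_circle) z = cnj (apply_bcontfun f z)"
  "apply_bcontfun (c *\<^sub>C f :: C_circle) z = c * apply_bcontfun f z"
  by (simp_all add: one_bcontfun.rep_eq times_bcontfun.rep_eq star_bcontfun.rep_eq
      scaleC_bcontfun.rep_eq star_complex_def scaleC_complex_def)

lemma C_circle_sum_apply:
  "apply_bcontfun (\<Sum>k\<in>K. f k :: C_circle) z = (\<Sum>k\<in>K. apply_bcontfun (f k) z)"
  by (induction K rule: infinite_finite_induct) auto

text \<open>The \<open>h k\<close> are square roots of normalized tent functions centred at a finite
  e-net. The squares are made to sum to 1 so that one copy of \<open>h k\<close> can stand on each
  side of a term, as in \<open>norm_sum_conj_le\<close>.\<close>

lemma ex_circle_partition:
  assumes "e > 0"
  shows "\<exists>K h. finite K \<and> (\<forall>k\<in>K. star (h k) = (h k :: C_circle)) \<and> (\<Sum>k\<in>K. h k * h k) = 1 \<and>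
    (\<forall>k\<in>K. \<forall>z. dist k z \<ge> e \<longrightarrow> apply_bcontfun (h k) z = 0)"
proof -
  have "seq_compact (UNIV :: circle set)" by (rule compact_imp_seq_compact[OF compact_circle])
  from seq_compact_imp_totally_bounded[OF this, rule_format, OF assms]
  obtain K :: "circle set" where K: "finite K" "UNIV \<subseteq> (\<Union>k\<in>K. ball k e)"
    by (elim exE conjE)
  define g where "g k z = max 0 (e - dist k z)" for k z :: circle
  let ?s = "\<lambda>z. \<Sum>j\<in>K. g j z"
  have s: "?s z > 0" for z
  proof -
    have "z \<in> (\<Union>k\<in>K. ball k e)" using K(2) by (rule subsetD) (rule UNIV_I)
    then obtain k where "k \<in> K" "dist k z < e" by auto
    then show ?thesis by (intro sum_pos2[OF K(1)]) (auto simp: g_def)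
  qed
  define h where "h k = (Bcontfun (\<lambda>z. complex_of_real (sqrt (g k z / ?s z))) :: C_circle)" for k
  have h: "apply_bcontfun (h k) z = complex_of_real (sqrt (g k z / ?s z))" for k z
    unfolding h_def
  proof (rule apply_bcontfun_Bcontfun)
    have "?s z \<noteq> 0" for z using s[of z] by simp
    then show "continuous_on UNIV (\<lambda>z. complex_of_real (sqrt (g k z / ?s z)))"
      unfolding g_def by (intro continuous_intros) auto
  qed
  have hh: "apply_bcontfun (h k * h k) z = complex_of_real (g k z / ?s z)" for k z
  proof -
    have "0 \<le> g k z / ?s z" using s[of z] by (simp add: g_def)
    then show ?thesis
      by (simp only: C_circle_apply h of_real_mult[symmetric] real_sqrt_mult_self abs_of_nonneg)
  qed
  have "(\<Sum>k\<in>K. h k * h k) = 1"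
  proof (rule bcontfun_eqI)
    fix z
    have "apply_bcontfun (\<Sum>k\<in>K. h k * h k) z = complex_of_real (\<Sum>k\<in>K. g k z / ?s z)"
      by (simp only: C_circle_sum_apply hh of_real_sum)
    also have "(\<Sum>k\<in>K. g k z / ?s z) = 1"
      using s[of z] by (simp flip: sum_divide_distrib)
    finally show "apply_bcontfun (\<Sum>k\<in>K. h k * h k) z = apply_bcontfun 1 z"
      by (simp add: C_circle_apply)
  qed
  moreover have "star (h k) = h k" for k
    by (rule bcontfun_eqI) (simp add: C_circle_apply h)
  moreover have "apply_bcontfun (h k) z = 0" if "dist k z \<ge> e" for k z
    using that by (simp add: h g_def)
  ultimately show ?thesis using K(1) by (intro exI[of _ K] exI[of _ h]) auto
qed

text \<open>At each point z the sum is a convex combination of values of f at those centres k with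
  \<open>h k\<close> nonzero at z, and these values are e-close to f(z).\<close>

lemma norm_partition_approx:
  fixes f :: C_circle
  assumes K: "finite K" "\<And>k. k \<in> K \<Longrightarrow> star (h k) = h k" "(\<Sum>k\<in>K. h k * h k) = 1"
    and near: "\<And>k z. k \<in> K \<Longrightarrow> apply_bcontfun (h k) z \<noteq> 0 \<Longrightarrow>
      cmod (apply_bcontfun f k - apply_bcontfun f z) \<le> e"
  shows "norm ((\<Sum>k\<in>K. apply_bcontfun f k *\<^sub>C (h k * h k)) - f) \<le> e"
proof (rule norm_bound)
  fix z
  let ?p = "\<lambda>k. apply_bcontfun (h k) z * apply_bcontfun (h k) z"
  \<comment> \<open>\<open>h k\<close> is real-valued, so its square equals its own modulus and can
    serve as a weight.\<close>
  have p: "?p k = complex_of_real (cmod (?p k))" if "k \<in> K" for k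
  proof -
    have "cnj (apply_bcontfun (h k) z) = apply_bcontfun (h k) z"
      using K(2)[OF that] by (metis C_circle_apply(3))
    then show ?thesis by (metis complex_norm_square norm_mult power2_eq_square)
  qed
  have one: "(\<Sum>k\<in>K. ?p k) = 1"
    using arg_cong[OF K(3), of "\<lambda>f. apply_bcontfun f z"] by (simp add: C_circle_apply C_circle_sum_apply)
  then have "complex_of_real (\<Sum>k\<in>K. cmod (?p k)) = 1" using p by simp
  then have one': "(\<Sum>k\<in>K. cmod (?p k)) = 1" by (simp only: of_real_eq_1_iff)
  have "apply_bcontfun f z = (\<Sum>k\<in>K. apply_bcontfun f z * ?p k)"
    by (simp add: one flip: sum_distrib_left)
  then have "norm (apply_bcontfun ((\<Sum>k\<in>K. apply_bcontfun f k *\<^sub>C (h k * h k)) - f) z) =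
      cmod (\<Sum>k\<in>K. (apply_bcontfun f k - apply_bcontfun f z) * ?p k)"
    by (simp add: C_circle_apply C_circle_sum_apply sum_subtractf left_diff_distrib)
  also have "\<dots> \<le> (\<Sum>k\<in>K. e * cmod (?p k))"
  proof (rule sum_norm_le)
    fix k assume k: "k \<in> K"
    show "cmod ((apply_bcontfun f k - apply_bcontfun f z) * ?p k) \<le> e * cmod (?p k)"
      using near[OF k, of z] by (cases "apply_bcontfun (h k) z = 0")
        (auto simp: norm_mult intro!: mult_right_mono)
  qed
  also have "\<dots> = e" by (simp only: one' sum_distrib_left[symmetric] mult_1_right)
  finally show "norm (apply_bcontfun ((\<Sum>k\<in>K. apply_bcontfun f k *\<^sub>C (h k * h k)) - f) z) \<le> e" .
qed

lemma haar_integrable: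
  fixes f :: C_circle
  shows "(\<lambda>s. apply_bcontfun f (Circle (cis (2 * pi * s)))) integrable_on {0..1}"
proof (rule integrable_continuous_interval)
  have "continuous_on {0..1} (\<lambda>s. Circle (cis (2 * pi * s)))"
    by (rule continuous_on_compose2[OF continuous_on_Circle]) (auto intro!: continuous_intros)
  then show "continuous_on {0..1} (\<lambda>s. apply_bcontfun f (Circle (cis (2 * pi * s))))"
    by (rule continuous_on_compose2[OF continuous_on_apply_bcontfun[of UNIV]]) auto
qed

text \<open>These are the properties that \<open>ex_slice\<close> demands of a functional.\<close>

lemma haar_circle_simps:
  "haar_circle (f + g) = haar_circle f + haar_circle g"
  "haar_circle (c *\<^sub>C f) = c * haar_circle f"
  "cmod (haar_circle f) \<le> norm f"
proof -
  show "haar_circle (f + g) = haar_circle f + haar_circle g"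
    unfolding haar_circle_def plus_bcontfun.rep_eq
    by (rule integral_add[OF haar_integrable haar_integrable])
  show "haar_circle (c *\<^sub>C f) = c * haar_circle f"
    by (simp add: haar_circle_def C_circle_apply)
  show "cmod (haar_circle f) \<le> norm f"
    using has_integral_bound_real[OF norm_ge_zero[of f] finite.emptyI
        integrable_integral[OF haar_integrable[of f]]]
    by (simp add: haar_circle_def norm_bounded)
qed

definition circle_powi :: "int \<Rightarrow> C_circle" where
  "circle_powi n = Bcontfun (\<lambda>z. of_circle z powi n)"

lemma circle_powi_apply: "apply_bcontfun (circle_powi n) z = of_circle z powi n"
  unfolding circle_powi_def
  by (rule apply_bcontfun_Bcontfun) (intro continuous_intros continuous_on_of_circle; simp)

lemma haar_circle_powi: "haar_circle (circle_powi n) = (if n = 0 then 1 else 0)"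
proof -
  have eq: "haar_circle (circle_powi n) = integral {0..1} (\<lambda>s. cis (2 * pi * n * s))"
    unfolding haar_circle_def circle_powi_apply
    by (rule integral_cong) (simp add: Circle_inverse cis_power_int mult_ac)
  show ?thesis
  proof (cases "n = 0")
    case False
    let ?c = "2 * pi * real_of_int n"
    \<comment> \<open>The antiderivative has period 1, so its values at the two endpoints
      cancel.\<close>
    have "((\<lambda>s. cis (?c * s)) has_integral (cis (?c * 1) / (\<i> * ?c) - cis (?c * 0) / (\<i> * ?c))) {0..1}"
    proof (rule fundamental_theorem_of_calculus)
      fix s :: real
      have "((\<lambda>s. cis (?c * s)) has_vector_derivative (?c *\<^sub>R (\<i> * cis (?c * s)))) (at s within {0..1})"
        unfolding has_vector_derivative_def
        by (auto intro!: derivative_eq_intros simp: fun_eq_iff scaleR_conv_of_real)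
      from has_vector_derivative_divide[OF this, of "\<i> * ?c"]
      show "((\<lambda>s. cis (?c * s) / (\<i> * ?c)) has_vector_derivative cis (?c * s)) (at s within {0..1})"
        using False by (simp add: scaleR_conv_of_real)
    qed simp
    moreover have "cis (?c * 1) = 1" by (simp add: cis_multiple_2pi)
    ultimately show ?thesis using False by (simp add: eq integral_unique)
  qed (use eq in simp)
qed

section \<open>Fibres of a tensor product with \<open>C(\<T>)\<close>\<close>

locale circle_tensor = spatial_tensor tens \<pi> \<rho> \<sigma>
  for tens :: "C_circle \<Rightarrow> 'b::cstar_algebra \<Rightarrow> 't::cstar_algebra" and \<pi> \<rho> \<sigma> +
  fixes e :: "circle \<Rightarrow> 't \<Rightarrow> 'b"
  assumes e_linear: "\<And>z. bounded_linear (e z)" and e_le: "\<And>z w. norm (e z w) \<le> norm w"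
    and e_tens: "\<And>z f y. e z (tens f y) = apply_bcontfun f z *\<^sub>C y"
begin

text \<open>The elements \<open>\<Sum>\<^sub>k h\<^sub>k\<^sup>2 \<otimes> e\<^sub>k w = \<Sum>\<^sub>k (h\<^sub>k \<otimes> 1) (1 \<otimes> e\<^sub>k w) (h\<^sub>k \<otimes> 1)\<close> given by partitions of unity \<open>h\<^sub>k\<^sup>2\<close>
  concentrated near \<open>k\<close> approximate \<open>w\<close>, and their norms are bounded by the norms of the \<open>e\<^sub>k w\<close>.\<close>

lemma norm_le_eval:
  assumes M: "\<And>z. norm (e z w) \<le> M"
  shows "norm w \<le> M"
proof -
  have "\<forall>n. \<exists>K h. finite K \<and> (\<forall>k\<in>K. star (h k) = (h k :: C_circle)) \<and> (\<Sum>k\<in>K. h k * h k) = 1 \<and>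
    (\<forall>k\<in>K. \<forall>z. dist k z \<ge> inverse (Suc n) \<longrightarrow> apply_bcontfun (h k) z = 0)"
    by (intro allI ex_circle_partition) simp
  then obtain K h where K: "\<And>n. finite (K n)" "\<And>n k. k \<in> K n \<Longrightarrow> star (h n k) = (h n k :: C_circle)"
      "\<And>n. (\<Sum>k\<in>K n. h n k * h n k) = 1"
    and far: "\<And>n k z. k \<in> K n \<Longrightarrow> dist k z \<ge> inverse (Suc n) \<Longrightarrow> apply_bcontfun (h n k) z = 0"
    by metis
  define T where "T n w = (\<Sum>k\<in>K n. tens (h n k * h n k) (e k w))" for n w
  note lin\<sigma> = star_hom_linear[OF hom(3)]
  \<comment> \<open>The estimate for conjugated sums concerns operators, so the sum is transported
    by the isometric \<open>\<sigma>\<close>. The element and the bound stay arbitrary because the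
    estimate is applied to an approximant of w.\<close>
  have T_le: "norm (T n w) \<le> M'" if M': "\<And>z. norm (e z w) \<le> M'" for n w M'
  proof -
    have nonneg: "0 \<le> M'" using order_trans[OF norm_ge_zero M'] .
    let ?h = "\<lambda>k. \<sigma> (tens (h n k) 1)" and ?y = "\<lambda>k. \<sigma> (tens 1 (e k w))"
    have "norm (\<Sum>k\<in>K n. ?h k * ?y k * ?h k) \<le> M'"
    proof (rule norm_sum_conj_le[OF K(1) _ _ _ nonneg])
      show "star (?h k) = ?h k" if "k \<in> K n" for k
        using K(2)[OF that] by (simp add: star_tens flip: star_homD(5)[OF hom(3)])
      have "(\<Sum>k\<in>K n. ?h k * ?h k) = \<sigma> (tens (\<Sum>k\<in>K n. h n k * h n k) 1)"
        by (simp add: tens_simps linear_sum[OF lin\<sigma>] linear_sum[OF star_hom_linear[OF star_hom_tens(1)]]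
            flip: star_homD(3)[OF hom(3)])
      then show "(\<Sum>k\<in>K n. ?h k * ?h k) = 1" by (simp add: K tens_simps star_homD[OF hom(3)])
      show "norm (?y k) \<le> M'" for k
        using norm_tens_le[of 1 "e k w"] M'[of k] isometric(3) by simp
    qed
    also have "(\<Sum>k\<in>K n. ?h k * ?y k * ?h k) = \<sigma> (T n w)"
      by (simp add: T_def linear_sum[OF lin\<sigma>] tens_simps flip: star_homD(3)[OF hom(3)])
    finally show ?thesis using isometric(3) by simp
  qed
  have span: "(\<lambda>n. T n w) \<longlonglongrightarrow> w" if "w \<in> span {tens x y |x y. True}" for w
    using that
  proof (induction rule: span_induct_alt)
    case base
    have "e k 0 = 0" for k using linear_0[OF bounded_linear.linear[OF e_linear]] .
    moreover have "tens x 0 = 0" for x using tens_simps(4)[of x 0 0] by simp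
    ultimately show ?case by (simp add: T_def)
  next
    case (step c x w)
    have "(\<lambda>n. T n (tens f y)) \<longlonglongrightarrow> tens f y" for f y
    proof (rule metric_LIMSEQ_I)
      fix r :: real assume r: "r > 0"
      \<comment> \<open>The summand 1 keeps the denominator positive when y = 0.\<close>
      define d where "d = r / (2 * (norm y + 1))"
      have ny: "0 < 2 * (norm y + 1)" by (smt (verit) norm_ge_zero)
      have d: "d > 0" using r ny by (simp add: d_def)
      have "d * norm y < r"
        using r ny by (simp add: d_def field_simps) (smt (verit) norm_ge_zero mult_nonneg_nonneg)
      have "uniformly_continuous_on UNIV (apply_bcontfun f)"
        by (rule compact_uniformly_continuous[OF _ compact_circle]) simp
      then obtain s where s: "s > 0"
        and f: "\<And>k z. dist k z < s \<Longrightarrow> dist (apply_bcontfun f k) (apply_bcontfun f z) < d"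
        using d unfolding uniformly_continuous_on_def by (metis UNIV_I dist_commute)
      obtain N where N: "inverse (real (Suc N)) < s" using s reals_Archimedean by blast
      have "dist (T n (tens f y)) (tens f y) < r" if n: "n \<ge> N" for n
      proof -
        have "T n (tens f y) = (\<Sum>k\<in>K n. tens (apply_bcontfun f k *\<^sub>C (h n k * h n k)) y)"
          by (simp add: T_def e_tens tens_simps)
        also have "\<dots> = tens (\<Sum>k\<in>K n. apply_bcontfun f k *\<^sub>C (h n k * h n k)) y"
          by (rule linear_sum[OF linear_tens, symmetric])
        finally have "T n (tens f y) - tens f y =
            tens ((\<Sum>k\<in>K n. apply_bcontfun f k *\<^sub>C (h n k * h n k)) - f) y"
          by (simp only: linear_diff[OF linear_tens])
        then have "dist (T n (tens f y)) (tens f y) \<le>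
            norm ((\<Sum>k\<in>K n. apply_bcontfun f k *\<^sub>C (h n k * h n k)) - f) * norm y"
          by (simp add: dist_norm norm_tens_le)
        also have "\<dots> \<le> d * norm y"
        proof (intro mult_right_mono norm_partition_approx K)
          fix k z assume k: "k \<in> K n" and "apply_bcontfun (h n k) z \<noteq> 0"
          then have "dist k z < inverse (real (Suc n))" using far[OF k, of z] by fastforce
          also have "\<dots> \<le> inverse (real (Suc N))" using n by simp
          finally show "cmod (apply_bcontfun f k - apply_bcontfun f z) \<le> d"
            using f[of k z] N by (simp add: dist_norm)
        qed simp_all
        finally show ?thesis using \<open>d * norm y < r\<close> by simp
      qed
      then show "\<exists>N. \<forall>n\<ge>N. dist (T n (tens f y)) (tens f y) < r" by blast
    qed
    then have "(\<lambda>n. T n x) \<longlonglongrightarrow> x" using step(1) by auto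
    then have "(\<lambda>n. c *\<^sub>R T n x + T n w) \<longlonglongrightarrow> c *\<^sub>R x + w" using step by (intro tendsto_intros)
    moreover have "tens f (r *\<^sub>R y) = r *\<^sub>R tens f y" for f r y
      by (simp add: scaleR_scaleC tens_simps)
    then have "T n (c *\<^sub>R x + w) = c *\<^sub>R T n x + T n w" for n
      using bounded_linear.linear[OF e_linear]
      by (simp add: T_def linear_add linear_scale tens_simps(2) scaleR_sum_right sum.distrib)
    ultimately show ?case by simp
  qed
  \<comment> \<open>Convergence of \<open>T n\<close> is known on the algebraic span only, so w is
    replaced by a w' within r/2. This costs r/2 in the fibre bound and r/2 in the norm.\<close>
  show ?thesis
  proof (rule field_le_epsilon)
    fix r :: real assume "r > 0"
    moreover have "w \<in> closure (span {tens x y |x y. True})" using dense by simp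
    ultimately obtain w' where w': "w' \<in> span {tens x y |x y. True}" "dist w' w < r / 2"
      unfolding closure_approachable by (metis half_gt_zero)
    have "norm (e z w') \<le> M + r / 2" for z
    proof -
      have "norm (e z w' - e z w) \<le> norm (w' - w)"
        using e_le[of z "w' - w"] by (simp add: linear_diff[OF bounded_linear.linear[OF e_linear]])
      then show ?thesis using M[of z] w'(2) norm_triangle_sub[of "e z w'" "e z w"] by (simp add: dist_norm)
    qed
    then have "norm (T n w') \<le> M + r / 2" for n by (rule T_le)
    then have "norm w' \<le> M + r / 2"
      using Lim_bounded[OF tendsto_norm[OF span[OF w'(1)]]] by blast
    then show "norm w \<le> M + r"
      using w'(2) norm_triangle_sub[of w w'] by (simp add: dist_norm norm_minus_commute)
  qed
qed

lemma eval_eqI: "(\<And>z. e z v = e z w) \<Longrightarrow> v = w"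
  using norm_le_eval[of "v - w" 0] by (simp add: linear_diff[OF bounded_linear.linear[OF e_linear]])

end

section \<open>Circle actions\<close>

text \<open>The spectral subspace of the character \<open>z\<^sup>n\<close>.\<close>

definition homogeneous :: "(circle \<Rightarrow> 'a \<Rightarrow> 'a) \<Rightarrow> int \<Rightarrow> 'a::cstar_algebra set" where
  "homogeneous \<alpha> n = {x. \<forall>z. \<alpha> z x = (of_circle z powi n) *\<^sub>C x}"

locale circle_action =
  fixes \<alpha> :: "circle \<Rightarrow> 'a::cstar_algebra \<Rightarrow> 'a"
  assumes \<alpha>: "\<And>z. star_hom (\<alpha> z)" and \<alpha>_le: "\<And>z x. norm (\<alpha> z x) \<le> norm x"
begin

lemma homogeneous_mult: "x \<in> homogeneous \<alpha> n \<Longrightarrow> y \<in> homogeneous \<alpha> m \<Longrightarrow> x * y \<in> homogeneous \<alpha> (n + m)"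
  by (simp add: homogeneous_def star_homD[OF \<alpha>] scaleC_mult_left scaleC_mult_right scaleC_scaleC
      power_int_add mult.commute)

lemma homogeneous_one: "1 \<in> homogeneous \<alpha> 0"
  by (simp add: homogeneous_def star_homD[OF \<alpha>])

lemma homogeneous_scaleC: "x \<in> homogeneous \<alpha> n \<Longrightarrow> c *\<^sub>C x \<in> homogeneous \<alpha> n"
  by (simp add: homogeneous_def star_homD[OF \<alpha>] scaleC_scaleC mult.commute)

lemma homogeneous_power: "x \<in> homogeneous \<alpha> 1 \<Longrightarrow> x ^ k \<in> homogeneous \<alpha> (int k)"
proof (induction k)
  case (Suc k)
  then show ?case using homogeneous_mult[of x 1 "x ^ k" "int k"] by simp
qed (simp add: homogeneous_one)

lemma bounded_linear_\<alpha>: "bounded_linear (\<alpha> z)"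
  using star_hom_linear[OF \<alpha>] \<alpha>_le
  by (intro bounded_linear_intro[where K = 1]) (simp_all add: linear_add linear_scale)

lemma homogeneous_closed: "subspace (homogeneous \<alpha> n)" "closed (homogeneous \<alpha> n)"
proof -
  have "homogeneous \<alpha> n = (\<Inter>z. {x. \<alpha> z x = (of_circle z powi n) *\<^sub>C x})"
    by (auto simp: homogeneous_def)
  then show "subspace (homogeneous \<alpha> n)" "closed (homogeneous \<alpha> n)"
    using subspace_eq[OF bounded_linear_\<alpha> bounded_linear_scaleC]
    by (auto intro!: subspace_Inter closed_INT)
qed

text \<open>On the circle, conjugation is inversion, so the adjoint reverses the degree.\<close>

lemma homogeneous_star:
  assumes "x \<in> homogeneous \<alpha> n"
  shows "star x \<in> homogeneous \<alpha> (- n)"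
proof -
  have "cnj (of_circle z powi n) = of_circle z powi (- n)" for z
  proof -
    have "cnj (of_circle z powi n) * of_circle z powi n = 1"
      using complex_norm_square[of "of_circle z powi n"] by (simp add: norm_power_int mult.commute)
    then show ?thesis by (simp add: power_int_minus field_simps)
  qed
  with assms show ?thesis by (simp add: homogeneous_def star_homD[OF \<alpha>] star_scaleC)
qed

lemma cstar_subalgebra_fixed: "cstar_subalgebra (homogeneous \<alpha> 0)"
  using homogeneous_mult[where n = 0 and m = 0] homogeneous_star[where n = 0] homogeneous_closed[of 0]
  by (auto simp: cstar_subalgebra_def homogeneous_one homogeneous_scaleC subspace_add)

lemma cstar_subalgebra_homogeneous: "cstar_subalgebra (closure (span (\<Union>n. homogeneous \<alpha> n)))"
  by (rule cstar_subalgebra_closure_span)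
     (blast intro: homogeneous_one homogeneous_mult homogeneous_scaleC homogeneous_star)+

end

text \<open>E is determined by its values on homogeneous elements, whose span is dense. The results
  below follow from this description and the contractivity of E.\<close>

locale circle_expectation = circle_action \<alpha>
  for \<alpha> :: "circle \<Rightarrow> 'a::cstar_algebra \<Rightarrow> 'a" +
  fixes E :: "'a \<Rightarrow> 'a"
  assumes dense: "closure (span (\<Union>n. homogeneous \<alpha> n)) = UNIV"
    and E: "bounded_linear E" and E_le: "\<And>x. norm (E x) \<le> norm x"
    and E_homogeneous: "\<And>n x. x \<in> homogeneous \<alpha> n \<Longrightarrow> E x = (if n = 0 then x else 0)"
begin

lemma eq_on_homogeneousI:
  assumes "bounded_linear F" "bounded_linear G" "\<And>n x. x \<in> homogeneous \<alpha> n \<Longrightarrow> F x = G x"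
  shows "F x = G x"
  by (rule bounded_linear_eqI[OF dense assms(1,2)]) (use assms(3) in auto)

text \<open>Multiplication by an element of degree 0 preserves degrees, so the bimodule identities
  hold on homogeneous elements and extend by continuity.\<close>

lemma conditional_expectation_fixed: "conditional_expectation (homogeneous \<alpha> 0) E"
proof -
  interpret E: bounded_linear E by (rule E)
  have "x \<in> E -` homogeneous \<alpha> 0" for x
  proof (rule dense_span_induct[OF dense])
    show "subspace (E -` homogeneous \<alpha> 0)"
      by (rule linear_subspace_vimage[OF E.linear_axioms homogeneous_closed(1)])
    show "closed (E -` homogeneous \<alpha> 0)"
      by (rule closed_vimage[OF homogeneous_closed(2) linear_continuous_on[OF E]])
    show "(\<Union>n. homogeneous \<alpha> n) \<subseteq> E -` homogeneous \<alpha> 0"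
      using E_homogeneous homogeneous_closed(1)[of 0] by (auto simp: subspace_0)
  qed
  moreover have "E (c *\<^sub>C x) = c *\<^sub>C E x" for c x
    by (rule eq_on_homogeneousI[where F = "\<lambda>x. E (c *\<^sub>C x)"])
       (auto intro!: bounded_linear_compose[OF E] bounded_linear_scaleC
          bounded_linear_compose[OF bounded_linear_scaleC E]
          simp: E_homogeneous[OF homogeneous_scaleC] E_homogeneous split: if_splits)
  moreover have "E (b * x) = b * E x" if b: "b \<in> homogeneous \<alpha> 0" for b x
    by (rule eq_on_homogeneousI[where F = "\<lambda>x. E (b * x)"])
       (use homogeneous_mult[OF b] E_homogeneous in \<open>fastforce intro!: bounded_linear_compose[OF E]
          bounded_linear_mult_right bounded_linear_compose[OF bounded_linear_mult_right E]\<close>)+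
  moreover have "E (x * b) = E x * b" if b: "b \<in> homogeneous \<alpha> 0" for b x
    by (rule eq_on_homogeneousI[where F = "\<lambda>x. E (x * b)"])
       (use homogeneous_mult[OF _ b] E_homogeneous in \<open>fastforce intro!: bounded_linear_compose[OF E]
          bounded_linear_mult_left bounded_linear_compose[OF bounded_linear_mult_left E]\<close>)+
  ultimately show ?thesis
    using E_homogeneous[of _ 0] E_le
    by (simp add: conditional_expectation_def cstar_subalgebra_fixed E.add)
qed

text \<open>If v has degree m, then \<open>v * D ^ n\<close> has degree m + n and is killed by E
  once n exceeds |m|. For general v the convergence follows by density.\<close>

lemma E_mult_power_tendsto_0:
  assumes D: "D \<in> homogeneous \<alpha> 1" "star D * D = 1"
  shows "(\<lambda>n. E (v * D ^ n)) \<longlonglongrightarrow> 0"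
proof -
  interpret E: bounded_linear E by (rule E)
  let ?V = "{v. (\<lambda>n. E (v * D ^ n)) \<longlonglongrightarrow> 0}"
  \<comment> \<open>This bounds the maps sending v to \<open>E (v * D ^ n)\<close> uniformly in n,
    which makes the set of admissible v closed.\<close>
  have normD: "norm (D ^ n) \<le> 1" for n
  proof -
    have "(norm D)\<^sup>2 = 1" using norm_star_mult_self[of D] D(2) by simp
    then have "norm D = 1" using power2_eq_iff_nonneg[of "norm D" 1] by simp
    then show ?thesis using norm_power_ineq[of D n] by simp
  qed
  have "v \<in> ?V"
  proof (rule dense_span_induct[OF dense])
    show "subspace ?V"
    proof (rule subspaceI)
      fix v w assume "v \<in> ?V" "w \<in> ?V"
      then show "v + w \<in> ?V"
        using tendsto_add[of "\<lambda>n. E (v * D ^ n)" 0 _ "\<lambda>n. E (w * D ^ n)" 0]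
        by (simp add: distrib_right E.add)
    next
      fix c v assume "v \<in> ?V"
      then show "c *\<^sub>R v \<in> ?V"
        using tendsto_scaleR[OF tendsto_const, of "\<lambda>n. E (v * D ^ n)" 0 _ c] by (simp add: E.scale)
    qed (simp add: E.zero)
    show "closed ?V"
      unfolding closed_sequential_limits
    proof (intro allI impI, elim conjE)
      fix f v assume f: "\<forall>k. f k \<in> ?V" and lim: "f \<longlonglongrightarrow> v"
      have "(\<lambda>n. E (v * D ^ n)) \<longlonglongrightarrow> 0"
      proof (rule metric_LIMSEQ_I)
        fix r :: real assume r: "r > 0"
        obtain k where k: "dist (f k) v < r / 2"
          using metric_LIMSEQ_D[OF lim, of "r / 2"] r by auto
        obtain N where N: "\<And>n. n \<ge> N \<Longrightarrow> norm (E (f k * D ^ n)) < r / 2"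
          using f metric_LIMSEQ_D[of "\<lambda>n. E (f k * D ^ n)" 0 "r / 2"] r by auto
        have "norm (E (v * D ^ n)) < r" if n: "n \<ge> N" for n
        proof -
          have "norm (E ((v - f k) * D ^ n)) \<le> norm (v - f k) * norm (D ^ n)"
            using E_le norm_mult_ineq by (rule order_trans)
          also have "\<dots> \<le> norm (v - f k) * 1" by (intro mult_left_mono normD) simp
          finally have "norm (E (v * D ^ n) - E (f k * D ^ n)) < r / 2"
            using k by (simp add: left_diff_distrib E.diff dist_norm norm_minus_commute)
          then show ?thesis using N[OF n] norm_triangle_sub[of "E (v * D ^ n)" "E (f k * D ^ n)"] by simp
        qed
        then show "\<exists>N. \<forall>n\<ge>N. dist (E (v * D ^ n)) 0 < r" by auto
      qed
      then show "v \<in> ?V" by simp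
    qed
    show "(\<Union>m. homogeneous \<alpha> m) \<subseteq> ?V"
    proof clarify
      fix m v assume v: "v \<in> homogeneous \<alpha> m"
      have "E (v * D ^ n) = 0" if "n > nat \<bar>m\<bar>" for n
      proof -
        have "m + int n \<noteq> 0" using that by linarith
        then show ?thesis
          using E_homogeneous[OF homogeneous_mult[OF v homogeneous_power[OF D(1), of n]]] by simp
      qed
      then show "(\<lambda>n. E (v * D ^ n)) \<longlonglongrightarrow> 0"
        by (intro tendsto_eventually) (auto simp: eventually_at_top_dense)
    qed
  qed
  then show ?thesis by simp
qed

lemma not_index_finite_type:
  assumes D: "D \<in> homogeneous \<alpha> 1" "star D * D = 1"
  shows "\<not> index_finite_type E"
proof
  assume "index_finite_type E"
  then obtain n u v where qb: "quasi_basis E n u v" unfolding index_finite_type_def by blast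
  have uv: "x = (\<Sum>j=1..n. u j * E (v j * x))" for x
    using qb unfolding quasi_basis_def by (elim allE conjE)
  \<comment> \<open>Finiteness of the quasi-basis enters here: the number of terms does not depend
    on k, so the limit passes through the sum.\<close>
  have "(\<lambda>k. \<Sum>j=1..n. u j * E (v j * D ^ k)) \<longlonglongrightarrow> (\<Sum>j=1..n. u j * 0)"
    by (intro tendsto_intros E_mult_power_tendsto_0 D)
  then have "(\<lambda>k. D ^ k) \<longlonglongrightarrow> 0"
    by (simp only: uv[symmetric] mult_zero_right sum.neutral_const)
  then have lim: "(\<lambda>k. star (D ^ k) * D ^ k) \<longlonglongrightarrow> star 0 * 0"
    by (intro tendsto_mult bounded_linear.tendsto[OF bounded_linear_star])
  have "star (D ^ k) * D ^ k = 1" for k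
  proof (induction k)
    case (Suc k)
    have "star (D ^ Suc k) * D ^ Suc k = star (D ^ k) * (star D * D) * D ^ k"
      by (simp only: power_Suc star_mult mult.assoc)
    with Suc show ?case by (simp add: D)
  qed simp
  with lim show False by (simp add: LIMSEQ_const_iff)
qed

end

section \<open>The expectation of \<open>C(U\<^sub>q(2))\<close>\<close>

theorem proposition4p4:
  fixes q :: complex
    and a b D :: "'a::cstar_algebra"
    and tens :: "'a \<Rightarrow> 'a \<Rightarrow> 't::cstar_algebra"
    and tensT :: "C_circle \<Rightarrow> 'a \<Rightarrow> 'u::cstar_algebra"
    and \<Delta> :: "'a \<Rightarrow> 't"
    and \<phi> :: "'a \<Rightarrow> C_circle"
  assumes "q \<noteq> 0" and "cmod q \<noteq> 1" and "Arg q / pi \<notin> \<rat>"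
    and "is_C_Uq2 q a b D"
    and "spatial_tensor_product tens"
    and "spatial_tensor_product tensT"
    and "uq2_comultiplication q a b D tens \<Delta>"
    and "star_hom \<phi>" and "\<phi> a = 1" and "\<phi> b = 0" and "\<phi> D = circle_t"
  shows "infinite_watatani_index (quotient_subalgebra tens tensT \<Delta> \<phi>)
           (quotient_expectation tens \<Delta> \<phi>)"
proof -
  have D: "star D * D = 1" and gen: "cstar_generates {a, b, D}"
    using assms(4) by (simp_all add: is_C_Uq2_def uq2_relations_def)
  have \<Delta>: "star_hom \<Delta>" "\<Delta> a = tens a a - cnj q *\<^sub>C tens b (D * star b)"
    "\<Delta> b = tens a b + tens b (D * star a)" "\<Delta> D = tens D D"
    using assms(7) by (simp_all add: uq2_comultiplication_def)
  obtain \<pi> \<rho> \<sigma> where "spatial_tensor tens \<pi> \<rho> \<sigma>"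
    using assms(5) unfolding spatial_tensor_product_def spatial_tensor_def by blast
  then interpret A: spatial_tensor tens \<pi> \<rho> \<sigma> .
  obtain \<pi>' \<rho>' \<sigma>' where "spatial_tensor tensT \<pi>' \<rho>' \<sigma>'"
    using assms(6) unfolding spatial_tensor_product_def spatial_tensor_def by blast
  then interpret T: spatial_tensor tensT \<pi>' \<rho>' \<sigma>' .

  \<comment> \<open>The isometric representation of \<open>C(\<T>)\<close> comes from the tensor
    product \<open>tensT\<close>; the one used next for the codomain of \<open>\<Delta>\<close> is
    \<open>\<sigma>\<close>.\<close>
  have \<phi>_le: "norm (\<phi> x) \<le> norm x" for x
    by (rule star_hom_le[OF assms(8) T.hom(1) T.isometric(1)])
  have \<Delta>_le: "norm (\<Delta> x) \<le> norm x" for x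
    by (rule star_hom_le[OF \<Delta>(1) A.hom(3) A.isometric(3)])
  have \<Delta>_linear: "bounded_linear \<Delta>"
    using star_hom_linear[OF \<Delta>(1)] \<Delta>_le
    by (intro bounded_linear_intro[where K = 1]) (simp_all add: linear_add linear_scale)

  have "\<forall>z. \<exists>F. bounded_linear F \<and> (\<forall>w. norm (F w) \<le> norm w) \<and>
      (\<forall>f y. F (tensT f y) = apply_bcontfun f z *\<^sub>C y)"
    by (intro allI T.ex_slice norm_bounded) (simp_all add: C_circle_apply)
  then obtain e where "\<And>z. bounded_linear (e z)" "\<And>z w. norm (e z w) \<le> norm w"
    "\<And>z f y. e z (tensT f y) = apply_bcontfun f z *\<^sub>C y" by metis
  then interpret T: circle_tensor tensT \<pi>' \<rho>' \<sigma>' e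
    by (intro circle_tensor.intro circle_tensor_axioms.intro T.spatial_tensor_axioms)

  have "\<forall>z. \<exists>F. bounded_linear F \<and> (\<forall>w. norm (F w) \<le> norm w) \<and>
      (\<forall>x y. F (tens x y) = apply_bcontfun (\<phi> x) z *\<^sub>C y)"
    by (intro allI A.ex_slice order_trans[OF norm_bounded \<phi>_le])
       (simp_all add: C_circle_apply star_homD[OF assms(8)])
  then obtain s where s: "\<And>z. bounded_linear (s z)" "\<And>z w. norm (s z w) \<le> norm w"
    "\<And>z x y. s z (tens x y) = apply_bcontfun (\<phi> x) z *\<^sub>C y" by metis
  \<comment> \<open>The sliced functional, \<open>\<phi>\<close> followed by evaluation at z, is a
    character, so its slice map respects products and adjoints.\<close>
  have s_hom: "star_hom (s z)" for z
    by (rule A.star_hom_on_tensI[OF s(1)])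
       (simp_all add: s(3) A.tens_simps(5) A.star_tens star_homD[OF assms(8)] C_circle_apply
          scaleC_mult_left scaleC_mult_right scaleC_scaleC star_scaleC mult.commute
          flip: A.tens_simps(3))

  \<comment> \<open>On these pairs the fibre of v at z is the slice \<open>s z w\<close>, which has
    norm at most that of w. A bound on all fibres bounds v itself, and so
    \<open>\<phi> \<otimes> id\<close> exists.\<close>
  have le: "norm v \<le> norm w" if "(w, v) \<in> span {(tens x y, tensT (\<phi> x) y) |x y. True}" for w v
  proof (rule T.norm_le_eval)
    fix z
    have "(w, v) \<in> {p. s z (fst p) = e z (snd p)}"
    proof (rule subsetD[OF span_minimal that])
      show "subspace {p. s z (fst p) = e z (snd p)}"
        by (rule subspace_eq(1)[OF bounded_linear_compose[OF s(1) bounded_linear_fst]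
              bounded_linear_compose[OF T.e_linear bounded_linear_snd]])
    qed (auto simp: s(3) T.e_tens)
    then show "norm (e z v) \<le> norm w" using s(2)[of z w] by simp
  qed
  have "\<exists>F. bounded_linear F \<and> (\<forall>w. norm (F w) \<le> norm w) \<and>
      (\<forall>x y. F (tens x y) = tensT (\<phi> x) y)"
    by (rule A.ex_bounded_on_tens) (rule le)
  then obtain F where F: "bounded_linear F"
    "\<And>w. norm (F w) \<le> norm w" "\<And>x y. F (tens x y) = tensT (\<phi> x) y" by blast
  have e_F: "e z (F w) = s z w" for z w
    by (rule A.eq_on_tensI[where F = "\<lambda>w. e z (F w)"])
       (auto intro!: bounded_linear_compose[OF T.e_linear F(1)] s(1) simp: F(3) s(3) T.e_tens)
  have "\<exists>H. bounded_linear H \<and> (\<forall>w. norm (H w) \<le> norm w) \<and>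
      (\<forall>f y. H (tensT f y) = haar_circle f *\<^sub>C y)"
    by (intro T.ex_slice haar_circle_simps)
  then obtain H where H: "bounded_linear H" "\<And>w. norm (H w) \<le> norm w"
    "\<And>f y. H (tensT f y) = haar_circle f *\<^sub>C y" by blast

  define \<alpha> where "\<alpha> z x = s z (\<Delta> x)" for z x
  have map_F: "tensor_map tens tensT \<phi> id = F"
    by (rule A.tensor_map_eqI[OF F(1)]) (simp add: F(3))
  \<comment> \<open>Uniqueness identifies \<open>(h \<circ> \<phi>) \<otimes> id\<close> with the
    Haar slice applied after \<open>\<phi> \<otimes> id\<close>.\<close>
  have "tensor_map tens (*\<^sub>C) (haar_circle \<circ> \<phi>) id = (\<lambda>w. H (F w))"
    by (rule A.tensor_map_eqI[OF bounded_linear_compose[OF H(1) F(1)]]) (simp add: F(3) H(3))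
  then have E: "quotient_expectation tens \<Delta> \<phi> = (\<lambda>x. H (F (\<Delta> x)))"
    by (simp add: quotient_expectation_def o_def)
  \<comment> \<open>Both sides have fibre \<open>z\<^sup>n x\<close> at each z.\<close>
  have F_homogeneous: "F (\<Delta> x) = tensT (circle_powi n) x" if "x \<in> homogeneous \<alpha> n" for n x
    using that by (intro T.eval_eqI) (simp add: e_F T.e_tens circle_powi_apply homogeneous_def \<alpha>_def)
  \<comment> \<open>The element \<open>tensT 1 x\<close> has constant fibre x, so the defining
    equation says that every \<open>\<alpha> z\<close> fixes x.\<close>
  have B: "quotient_subalgebra tens tensT \<Delta> \<phi> = homogeneous \<alpha> 0"
  proof -
    have "F (\<Delta> x) = tensT 1 x \<longleftrightarrow> (\<forall>z. e z (F (\<Delta> x)) = e z (tensT 1 x))" for x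
      using T.eval_eqI by metis
    then show ?thesis
      by (simp add: quotient_subalgebra_def map_F homogeneous_def \<alpha>_def e_F T.e_tens C_circle_apply)
  qed

  have \<alpha>_hom: "star_hom (\<alpha> z)" for z
    unfolding \<alpha>_def by (rule star_hom_comp[OF s_hom \<Delta>(1)])
  \<comment> \<open>Since \<open>\<phi> b = 0\<close>, the second summands of
    \<open>\<Delta> a\<close> and \<open>\<Delta> b\<close> vanish; \<open>\<phi> a = 1\<close>
    leaves a and b, and \<open>\<phi> D\<close> takes the value z at z.\<close>
  have \<alpha>_gen: "\<alpha> z a = a" "\<alpha> z b = b" "\<alpha> z D = of_circle z *\<^sub>C D" for z
    using linear_diff[OF star_hom_linear[OF s_hom[of z]]]
    by (simp_all add: \<alpha>_def \<Delta> star_homD[OF s_hom] s(3) assms(9-11) C_circle_apply circle_t.rep_eq)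
  have "norm (\<alpha> z x) \<le> norm x" for z x
    unfolding \<alpha>_def by (meson s(2) \<Delta>_le order_trans)
  then interpret circle_action \<alpha> by (intro circle_action.intro \<alpha>_hom)
  let ?S = "\<Union>n. homogeneous \<alpha> n"
  have D1: "D \<in> homogeneous \<alpha> 1" and "a \<in> homogeneous \<alpha> 0" "b \<in> homogeneous \<alpha> 0"
    by (simp_all add: homogeneous_def \<alpha>_gen)
  then have "{a, b, D} \<subseteq> ?S" by blast
  then have "{a, b, D} \<subseteq> closure (span ?S)" by (meson closure_subset order_trans span_superset)
  then have dense: "closure (span ?S) = UNIV"
    using gen cstar_subalgebra_homogeneous unfolding cstar_generates_def by blast

  interpret circle_expectation \<alpha> "quotient_expectation tens \<Delta> \<phi>"
  proof (intro circle_expectation.intro circle_expectation_axioms.intro circle_action_axioms)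
    show "bounded_linear (quotient_expectation tens \<Delta> \<phi>)"
      unfolding E by (intro bounded_linear_compose[OF H(1)] bounded_linear_compose[OF F(1)] \<Delta>_linear)
    show "norm (quotient_expectation tens \<Delta> \<phi> x) \<le> norm x" for x
      unfolding E by (meson H(2) F(2) \<Delta>_le order_trans)
    show "quotient_expectation tens \<Delta> \<phi> x = (if n = 0 then x else 0)" if "x \<in> homogeneous \<alpha> n" for n x
      by (simp add: E F_homogeneous[OF that] H(3) haar_circle_powi)
  qed (fact dense)
  show ?thesis
    unfolding infinite_watatani_index_def B
    using conditional_expectation_fixed not_index_finite_type[OF D1 D] by blast
qed

end
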